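(* Let $F:\mathbb{R}^n\to\mathbb{R}^n$ be a function in $\mathrm{span}(\Phi_{\rm abs})$ (with a fixed evaluation procedure) and assume that $F(x^* )=0$ for some $x^*\in\mathbb{R}^n$. If the tangent mode piecewise linearization $\lozenge_{x^*}F$ is metrically regular in some open neighborhood of $x^*$, then $F$ is open in $x^*$.
   Context: Elemental functions and PCS functions: $\Phi$ is a library of elemental functions consisting of the binary arithmetic operations and unary functions (such as $\sin,\cos,\exp,\log,\dots$), each differentiable with (locally) Lipschitz continuous derivative on its open domain; $\Phi_{\rm abs}=\Phi\cup\{\mathrm{abs}\}$ with $\mathrm{abs}(x)=|x|$. A function $F$ belongs to $\mathrm{span}(\Phi_{\rm abs})$ (is piecewise composite smooth, PCS) if it is computed by an evaluation procedure: a finite sequence of intermediate values $v_i$, beginning with the components of $x$ and ending with the components of $F(x)$, in which each further $v_i$ is $v_j\pm v_k$, $v_j * v_k$, $\varphi_i(v_j)$ with $\varphi_i\in\Phi$ unary, or $\mathrm{abs}(v_j)$ for earlier values $v_j,v_k$ (division is written as multiplication by a reciprocal; constants are allowed). The procedure is assumed well defined near all reference points considered. Tangent mode piecewise linearization at $\mathring x$: let $\mathring v_i$ be the values of the procedure at $\mathring x$. Starting from $\Delta x=x-\mathring x$, set $\Delta v_i=\Delta v_j\pm\Delta v_k$ if $v_i=v_j\pm v_k$; $\Delta v_i=\mathring v_j\Delta v_k+\Delta v_j\mathring v_k$ if $v_i=v_j*v_k$; $\Delta v_i=\varphi_i'(\mathring v_j)\Delta v_j$ if $v_i=\varphi_i(v_j)$;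 $\Delta v_i=|\mathring v_j+\Delta v_j|-|\mathring v_j|$ if $v_i=|v_j|$. The resulting output increment is $\Delta F(\mathring x;\Delta x)$, and $\lozenge_{\mathring x}F(x)=F(\mathring x)+\Delta F(\mathring x;x-\mathring x)$, a continuous piecewise linear function of $x\in\mathbb{R}^n$. A locally Lipschitz continuous function $P:\mathbb{R}^n\to\mathbb{R}^m$ is metrically regular at $\bar x$ if there exist a constant $c>0$ and neighborhoods $\mathcal{U}$ of $\bar x$ and $\mathcal{V}$ of $P(\bar x)$ such that $\operatorname{dist}(x,P^{-1}(y))\le c\|y-P(x)\|$ for all $x\in\mathcal{U}$, $y\in\mathcal{V}$ (with $\operatorname{dist}(x,\varnothing)=\infty$). It is metrically regular on an open set if it is metrically regular at every point of that set. $F$ is open in $x^*$ if the image under $F$ of every neighborhood of $x^*$ is a neighborhood of $F(x^* )$. *)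

theory Defs
  imports "HOL-Analysis.Analysis"
begin

section \<open>Elemental functions and evaluation procedures\<close>

definition locally_lipschitz_on :: "real set \<Rightarrow> (real \<Rightarrow> real) \<Rightarrow> bool" where
  "locally_lipschitz_on D g \<longleftrightarrow>
     (\<forall>t\<in>D. \<exists>e>0. \<exists>L. L-lipschitz_on (cball t e \<inter> D) g)"

text \<open>A unary elemental function is a pair of its domain and a total function, of which only the
  values on the domain matter. Division is multiplication by the elemental function
  \<open>(- {0}, inverse)\<close>.\<close>

type_synonym elemental = "real set \<times> (real \<Rightarrow> real)"

text \<open>The library is represented by its set of unary functions; the binary arithmetic operations
  and the absolute value are built into the type \<open>operation\<close> below.\<close>

definition elemental_library :: "elemental set \<Rightarrow> bool" where
  "elemental_library \<Phi> \<longleftrightarrow>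
     (\<forall>(D, \<phi>)\<in>\<Phi>. open D \<and> \<phi> differentiable_on D \<and> locally_lipschitz_on D (deriv \<phi>))"

text \<open>The natural numbers are positions, counted from 0, in the list of all intermediate values,
  which starts with the components of the argument.\<close>

datatype operation =
    Const real
  | Add nat nat
  | Sub nat nat
  | Mul nat nat
  | Elem elemental nat
  | Abs nat

fun operands :: "operation \<Rightarrow> nat set" where
  "operands (Const c) = {}"
| "operands (Add j k) = {j, k}"
| "operands (Sub j k) = {j, k}"
| "operands (Mul j k) = {j, k}"
| "operands (Elem f j) = {j}"
| "operands (Abs j) = {j}"

text \<open>An evaluation procedure from \<open>n\<close> inputs to \<open>m\<close> outputs: its \<open>i\<close>-th operation computes the
  value at position \<open>n + i\<close> from earlier values, and the last \<open>m\<close> values are the outputs.\<close>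

definition evaluation_procedure :: "elemental set \<Rightarrow> nat \<Rightarrow> nat \<Rightarrow> operation list \<Rightarrow> bool" where
  "evaluation_procedure \<Phi> n m ops \<longleftrightarrow>
     m \<le> n + length ops \<and>
     (\<forall>i<length ops. operands (ops ! i) \<subseteq> {..<n + i} \<and>
        (\<forall>f j. ops ! i = Elem f j \<longrightarrow> f \<in> \<Phi>))"

fun op_value :: "real list \<Rightarrow> operation \<Rightarrow> real" where
  "op_value v (Const c) = c"
| "op_value v (Add j k) = v ! j + v ! k"
| "op_value v (Sub j k) = v ! j - v ! k"
| "op_value v (Mul j k) = v ! j * v ! k"
| "op_value v (Elem f j) = snd f (v ! j)"
| "op_value v (Abs j) = \<bar>v ! j\<bar>"

fun run :: "operation list \<Rightarrow> real list \<Rightarrow> real list" where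
  "run [] v = v"
| "run (a # ops) v = run ops (v @ [op_value v a])"

text \<open>The index type of \<open>real ^ 'n\<close> carries no order, so the order in which components are listed
  is given by a numbering \<open>\<iota>\<close>.\<close>

definition numbering :: "('n::finite \<Rightarrow> nat) \<Rightarrow> bool" where
  "numbering \<iota> \<longleftrightarrow> bij_betw \<iota> UNIV {..<CARD('n)}"

definition components :: "('n::finite \<Rightarrow> nat) \<Rightarrow> real ^ 'n \<Rightarrow> real list" where
  "components \<iota> x = map (\<lambda>k. x $ inv \<iota> k) [0..<CARD('n)]"

definition final_vector :: "('m::finite \<Rightarrow> nat) \<Rightarrow> real list \<Rightarrow> real ^ 'm" where
  "final_vector \<kappa> v = (\<chi> i. v ! (length v - CARD('m) + \<kappa> i))"

definition eval_procedure ::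
    "('n::finite \<Rightarrow> nat) \<Rightarrow> ('m::finite \<Rightarrow> nat) \<Rightarrow> operation list \<Rightarrow> real ^ 'n \<Rightarrow> real ^ 'm" where
  "eval_procedure \<iota> \<kappa> ops x = final_vector \<kappa> (run ops (components \<iota> x))"

definition well_defined_at ::
    "('n::finite \<Rightarrow> nat) \<Rightarrow> operation list \<Rightarrow> real ^ 'n \<Rightarrow> bool" where
  "well_defined_at \<iota> ops x \<longleftrightarrow>
     (\<forall>D \<phi> j. Elem (D, \<phi>) j \<in> set ops \<longrightarrow> run ops (components \<iota> x) ! j \<in> D)"

definition computed_on ::
    "elemental set \<Rightarrow> ('n::finite \<Rightarrow> nat) \<Rightarrow> ('m::finite \<Rightarrow> nat) \<Rightarrow> operation list \<Rightarrow>
     (real ^ 'n) set \<Rightarrow> (real ^ 'n \<Rightarrow> real ^ 'm) \<Rightarrow> bool" where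
  "computed_on \<Phi> \<iota> \<kappa> ops U F \<longleftrightarrow>
     evaluation_procedure \<Phi> CARD('n) CARD('m) ops \<and>
     (\<forall>x\<in>U. well_defined_at \<iota> ops x \<and> F x = eval_procedure \<iota> \<kappa> ops x)"


section \<open>Tangent mode piecewise linearization\<close>

text \<open>Here \<open>v\<close> is the complete list of values at the reference point and \<open>d\<close> the list of the
  increments computed so far.\<close>

fun op_increment :: "real list \<Rightarrow> real list \<Rightarrow> operation \<Rightarrow> real" where
  "op_increment v d (Const c) = 0"
| "op_increment v d (Add j k) = d ! j + d ! k"
| "op_increment v d (Sub j k) = d ! j - d ! k"
| "op_increment v d (Mul j k) = v ! j * d ! k + d ! j * v ! k"
| "op_increment v d (Elem f j) = deriv (snd f) (v ! j) * d ! j"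
| "op_increment v d (Abs j) = \<bar>v ! j + d ! j\<bar> - \<bar>v ! j\<bar>"

fun run_increments :: "real list \<Rightarrow> operation list \<Rightarrow> real list \<Rightarrow> real list" where
  "run_increments v [] d = d"
| "run_increments v (a # ops) d = run_increments v ops (d @ [op_increment v d a])"

definition tangent_increment ::
    "('n::finite \<Rightarrow> nat) \<Rightarrow> ('m::finite \<Rightarrow> nat) \<Rightarrow> operation list \<Rightarrow>
     real ^ 'n \<Rightarrow> real ^ 'n \<Rightarrow> real ^ 'm" where
  "tangent_increment \<iota> \<kappa> ops x0 \<Delta>x =
     final_vector \<kappa> (run_increments (run ops (components \<iota> x0)) ops (components \<iota> \<Delta>x))"

definition piecewise_linearization ::
    "('n::finite \<Rightarrow> nat) \<Rightarrow> ('m::finite \<Rightarrow> nat) \<Rightarrow> operation list \<Rightarrow>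
     real ^ 'n \<Rightarrow> real ^ 'n \<Rightarrow> real ^ 'm" where
  "piecewise_linearization \<iota> \<kappa> ops x0 x =
     eval_procedure \<iota> \<kappa> ops x0 + tangent_increment \<iota> \<kappa> ops x0 (x - x0)"


section \<open>Metric regularity and openness at a point\<close>

text \<open>Valued in \<open>ennreal\<close> so that the distance to the empty set is \<open>\<infinity>\<close>; for \<open>infdist\<close> it is 0.\<close>

definition set_distance :: "'a::metric_space \<Rightarrow> 'a set \<Rightarrow> ennreal" where
  "set_distance x A = (INF z\<in>A. ennreal (dist x z))"

text \<open>Local Lipschitz continuity of \<open>P\<close> is not part of this definition; piecewise
  linearizations always have it.\<close>

definition metrically_regular_at ::
    "('a::real_normed_vector \<Rightarrow> 'b::real_normed_vector) \<Rightarrow> 'a \<Rightarrow> bool" where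
  "metrically_regular_at P a \<longleftrightarrow>
     (\<exists>c>0. \<exists>U V. a \<in> interior U \<and> P a \<in> interior V \<and>
        (\<forall>x\<in>U. \<forall>y\<in>V. set_distance x (P -` {y}) \<le> ennreal (c * norm (y - P x))))"

definition metrically_regular_on ::
    "('a::real_normed_vector \<Rightarrow> 'b::real_normed_vector) \<Rightarrow> 'a set \<Rightarrow> bool" where
  "metrically_regular_on P W \<longleftrightarrow> (\<forall>a\<in>W. metrically_regular_at P a)"

definition open_in_point ::
    "('a::topological_space \<Rightarrow> 'b::topological_space) \<Rightarrow> 'a \<Rightarrow> bool" where
  "open_in_point F a \<longleftrightarrow> (\<forall>N. a \<in> interior N \<longrightarrow> F a \<in> interior (F ` N))"

end

theory Submission
  imports Defs "HOL-Library.Landau_Symbols"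
begin

text \<open>Let \<open>P\<close> be the piecewise linearization at \<open>x*\<close>. Then \<open>F = P + o(|x - x*|)\<close>, but \<open>F - P\<close>
  is not a small Lipschitz perturbation because the kinks of \<open>F\<close> and \<open>P\<close> differ, so stability of
  metric regularity does not apply and a degree argument is used instead. Metric regularity makes
  the affine pieces of \<open>P\<close> near \<open>x*\<close> nonsingular with determinants of one sign, and gives
  \<open>|P x - P x*| \<ge> \<kappa> |x - x*|\<close>. If \<open>F\<close> missed a value \<open>y\<close> near \<open>F x*\<close> on a small ball, a polynomial
  approximation of \<open>F\<close>, glued to \<open>P\<close> near the sphere, would be a map \<open>Q\<close> that agrees with \<open>P\<close>
  outside the ball and stays away from \<open>y\<close>. But the integral of \<open>det Dh\<close> over the ball depends only
  on \<open>h\<close> outside the ball; for \<open>h = \<Psi> \<circ> P\<close> and \<open>h = \<Psi> \<circ> Q\<close>, with \<open>\<Psi>\<close> chosen such that \<open>det D\<Psi>\<close> is a bump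
  function at \<open>y\<close>, it is nonzero and zero, respectively.\<close>


section \<open>The integral of a Jacobian determinant\<close>

text \<open>The degree enters only through the integral of a Jacobian determinant, so the kinks, a
  negligible set, cost nothing and no regular values of the approximating map have to be discussed.
  Metric regularity does three separate jobs. It makes P open at every point near the reference
  point. Openness forces each affine piece on an open set to be nonsingular and forbids a fold, that
  is, opposite orientations on the two sides of a hyperplane. Points where different hyperplanes
  meet have codimension at least two, so a generic segment avoids them and the sign propagates along
  it. Finally, the inverse estimate for the fibre through the reference point turns into linear
  growth, once the nonsingular pieces have shown this point to be isolated in its fibre. Linear
  growth against a little-o error is what leaves room, on the outer half of the ball, for both the
  gluing and the polynomial approximation.\<close>

lemma degree_poly_difference:
  fixes p :: "real poly"
  assumes "degree p \<le> Suc n"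
  shows "degree (pcompose p [:M, 1:] - p) \<le> n"
proof (cases "degree p = 0")
  case True
  then obtain c where "p = [:c:]" using degree_eq_zeroE by blast
  then show ?thesis by (simp add: pcompose_const)
next
  case False
  have d: "degree (pcompose p [:M, 1:]) = degree p"
    by (simp add: degree_pcompose)
  have l: "lead_coeff (pcompose p [:M, 1:]) = lead_coeff p"
    by (subst lead_coeff_comp) simp_all
  have "degree (pcompose p [:M, 1:] - p) < degree p"
  proof (cases "pcompose p [:M, 1:] - p = 0")
    case True
    then show ?thesis using False by simp
  next
    case nz: False
    have "degree (pcompose p [:M, 1:] - p) \<le> degree p"
      using d by (intro degree_diff_le) auto
    moreover have "coeff (pcompose p [:M, 1:] - p) (degree p) = 0"
      using l d by simp
    ultimately show ?thesis
      using nz by (metis le_neq_implies_less leading_coeff_0_iff)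
  qed
  then show ?thesis using assms by simp
qed

text \<open>The weights do not depend on p, so they can later recover det A from det (s I + A) at
  large s. In the induction the forward difference p(x + M) - p(x) has a smaller degree bound, and
  its value at 0 is p(M) - p(0).\<close>

lemma poly_extrapolation_at_0:
  fixes M :: real
  shows "\<exists>c. \<forall>p. degree p \<le> n \<longrightarrow> poly p 0 = (\<Sum>j\<le>n. c j * poly p (M * real (Suc j)))"
proof (induction n)
  case 0
  have "poly p 0 = (\<Sum>j\<le>0. 1 * poly p (M * real (Suc j)))" if "degree p \<le> 0" for p :: "real poly"
    using that degree_eq_zeroE[of p] by force
  then show ?case by (intro exI[of _ "\<lambda>_. 1"]) blast
next
  case (Suc n)
  then obtain c where c: "\<And>p. degree p \<le> n \<Longrightarrow> poly p 0 = (\<Sum>j\<le>n. c j * poly p (M * real (Suc j)))"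
    by blast
  \<comment> \<open>The coefficients of p(0) = y 0 + sum of c j * y j - sum of c j * y (j + 1),
    where y j = p(M (j + 1)), collected by index.\<close>
  define c' where "c' j = (if j = 0 then 1 else 0) + (if j \<le> n then c j else 0) - (if j = 0 then 0 else c (j - 1))" for j
  have "poly p 0 = (\<Sum>j\<le>Suc n. c' j * poly p (M * real (Suc j)))" if p: "degree p \<le> Suc n" for p
  proof -
    define y where "y j = poly p (M * real (Suc j))" for j
    have "poly (pcompose p [:M, 1:] - p) 0 = (\<Sum>j\<le>n. c j * (y (Suc j) - y j))"
      unfolding c[OF degree_poly_difference[OF p]] y_def
      by (simp add: poly_pcompose algebra_simps)
    then have "poly p 0 = y 0 + (\<Sum>j\<le>n. c j * y j) - (\<Sum>j\<le>n. c j * y (Suc j))"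
      by (simp add: poly_pcompose y_def right_diff_distrib sum_subtractf)
    also have "(\<Sum>j\<le>n. c j * y j) = (\<Sum>j\<le>Suc n. (if j \<le> n then c j else 0) * y j)"
      by simp
    also have "(\<Sum>j\<le>n. c j * y (Suc j)) = (\<Sum>j\<le>Suc n. (if j = 0 then 0 else c (j - 1)) * y j)"
      by (subst sum.atMost_Suc_shift) simp
    also have "y 0 = (\<Sum>j\<le>Suc n. (if j = 0 then 1 else 0) * y j)"
      by (subst sum.atMost_Suc_shift) simp
    finally show ?thesis
      unfolding c'_def y_def by (simp only: sum.distrib sum_subtractf distrib_right left_diff_distrib)
  qed
  then show ?case by blast
qed

lemma det_matrix_pencil_poly:
  fixes A B :: "real^'n^'n"
  shows "\<exists>p. degree p \<le> CARD('n) \<and> (\<forall>s. poly p s = det (s *\<^sub>R B + A))"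
proof (intro exI conjI allI)
  define q where "q \<sigma> i = [:A $ i $ \<sigma> i, B $ i $ \<sigma> i:]" for \<sigma> and i :: 'n
  let ?p = "\<Sum>\<sigma> | \<sigma> permutes (UNIV::'n set). smult (of_int (sign \<sigma>)) (\<Prod>i\<in>UNIV. q \<sigma> i)"
  show "poly ?p s = det (s *\<^sub>R B + A)" for s
    unfolding det_def poly_sum poly_smult poly_prod
    by (simp add: q_def add.commute)
  show "degree ?p \<le> CARD('n)"
  proof (rule degree_sum_le)
    fix \<sigma>
    have "degree (\<Prod>i\<in>UNIV. q \<sigma> i) \<le> (\<Sum>i\<in>(UNIV::'n set). degree (q \<sigma> i))"
      using degree_prod_sum_le[of UNIV "q \<sigma>"] by (simp add: comp_def)
    also have "\<dots> \<le> (\<Sum>i\<in>(UNIV::'n set). 1)"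
      by (rule sum_mono) (simp add: q_def)
    finally have "degree (\<Prod>i\<in>UNIV. q \<sigma> i) \<le> CARD('n)"
      by simp
    then show "degree (smult (of_int (sign \<sigma>)) (\<Prod>i\<in>UNIV. q \<sigma> i)) \<le> CARD('n)"
      by (rule order_trans[OF degree_smult_le])
  qed (simp add: finite_permutations)
qed

text \<open>\<open>t A + B\<close> stays invertible for t in [0, 1], so its determinant, a
  polynomial in t, keeps the sign that it has at t = 0.\<close>

lemma det_pos_along_segment:
  fixes A B :: "real^'n^'n"
  assumes pos: "det B > 0"
    and inj: "\<And>t v. 0 \<le> t \<Longrightarrow> t \<le> 1 \<Longrightarrow> t *\<^sub>R (A *v v) + B *v v = 0 \<Longrightarrow> v = 0"
  shows "det (A + B) > 0"
proof -
  define f where "f t = det (t *\<^sub>R A + B)" for t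
  obtain p where "\<forall>t. poly p t = f t"
    using det_matrix_pencil_poly[of A B] unfolding f_def by blast
  then have "f = poly p" by auto
  moreover have "continuous_on {0..1} (poly p)"
    by (intro continuous_at_imp_continuous_on ballI poly_isCont)
  ultimately have cont: "continuous_on {0..1} f" by simp
  have nz: "f t \<noteq> 0" if "0 \<le> t" "t \<le> 1" for t
  proof -
    have "(t *\<^sub>R A + B) *v v = t *\<^sub>R (A *v v) + B *v v" for v
      unfolding matrix_vector_mult_add_rdistrib scaleR_matrix_vector_assoc ..
    then have "inj ((*v) (t *\<^sub>R A + B))"
      using inj[OF that] unfolding linear_injective_0[OF matrix_vector_mul_linear] by metis
    then show ?thesis
      unfolding f_def using det_nz_iff_inj[of "(*v) (t *\<^sub>R A + B)"] by simp
  qed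
  show ?thesis
  proof (rule ccontr)
    assume "\<not> ?thesis"
    then have "f 1 \<le> 0" by (simp add: f_def)
    moreover have "f 0 \<ge> 0" using pos by (simp add: f_def)
    ultimately obtain t where "0 \<le> t" "t \<le> 1" "f t = 0"
      using IVT2'[of f 1 0 0] cont by auto
    with nz show False by blast
  qed
qed

section \<open>The maps s x + h x for large s\<close>

text \<open>Difference quotients along v are bounded by L |v|, and the bound survives the
  limit.\<close>

lemma has_derivative_lipschitz_norm_le:
  fixes f :: "'a::real_normed_vector \<Rightarrow> 'b::real_normed_vector"
  assumes lip: "L-lipschitz_on UNIV f" and der: "(f has_derivative f') (at x)"
  shows "norm (f' v) \<le> L * norm v"
proof -
  have "((\<lambda>t. x + t *\<^sub>R v) has_vector_derivative v) (at 0)"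
    by (auto intro!: derivative_eq_intros)
  then have "((\<lambda>t. f (x + t *\<^sub>R v)) has_vector_derivative f' v) (at 0)"
    using vector_derivative_diff_chain_within[of "\<lambda>t. x + t *\<^sub>R v" v 0 UNIV f f'] der
    by (simp add: has_derivative_at_withinI comp_def)
  then have "((\<lambda>t. (f (x + t *\<^sub>R v) - f x - t *\<^sub>R f' v) /\<^sub>R \<bar>t\<bar>) \<longlongrightarrow> 0) (at 0)"
    by (simp add: has_vector_derivative_def has_derivative_at_within)
  from tendsto_add[OF tendsto_norm_zero[OF this] tendsto_const]
  have "((\<lambda>t. norm ((f (x + t *\<^sub>R v) - f x - t *\<^sub>R f' v) /\<^sub>R \<bar>t\<bar>) + L * norm v) \<longlongrightarrow> 0 + L * norm v) (at 0)" .
  moreover have "\<forall>\<^sub>F t in at 0. norm (f' v) \<le> norm ((f (x + t *\<^sub>R v) - f x - t *\<^sub>R f' v) /\<^sub>R \<bar>t\<bar>) + L * norm v"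
    unfolding eventually_at_topological
  proof (intro exI[of _ UNIV] conjI ballI impI)
    fix t :: real assume "t \<noteq> 0"
    have "norm (f (x + t *\<^sub>R v) - f x) \<le> L * (\<bar>t\<bar> * norm v)"
      using lipschitz_onD[OF lip, of "x + t *\<^sub>R v" x] by (simp add: dist_norm)
    then have "\<bar>t\<bar> * norm (f' v) \<le> norm (f (x + t *\<^sub>R v) - f x - t *\<^sub>R f' v) + L * (\<bar>t\<bar> * norm v)"
      using norm_triangle_ineq2[of "t *\<^sub>R f' v" "f (x + t *\<^sub>R v) - f x"]
      by (simp add: norm_minus_commute)
    with \<open>t \<noteq> 0\<close> show "norm (f' v) \<le> norm ((f (x + t *\<^sub>R v) - f x - t *\<^sub>R f' v) /\<^sub>R \<bar>t\<bar>) + L * norm v"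
      by (simp only: norm_scaleR abs_inverse abs_abs) (simp add: field_simps)
  qed auto
  ultimately show ?thesis
    using tendsto_lowerbound by fastforce
qed

text \<open>For s > L the term s v outweighs t A v, so the segment from s I to s I + A contains no
  singular matrix.\<close>

lemma det_scaled_identity_plus_pos:
  fixes A :: "real^'n^'n"
  assumes "\<And>v. norm (A *v v) \<le> L * norm v" "s > L" "L \<ge> 0"
  shows "det (s *\<^sub>R mat 1 + A) > 0"
proof -
  have "det (A + s *\<^sub>R mat 1) > 0"
  proof (rule det_pos_along_segment)
    show "det (s *\<^sub>R mat 1 :: real^'n^'n) > 0"
      using assms(2,3) by (subst det_diagonal) (auto simp: mat_def intro!: prod_pos)
    fix t v assume t: "0 \<le> t" "t \<le> (1::real)" and "t *\<^sub>R (A *v v) + (s *\<^sub>R mat 1) *v v = 0"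
    then have eq: "s *\<^sub>R v = - (t *\<^sub>R (A *v v))"
      by (simp add: scaleR_matrix_vector_assoc[symmetric] eq_neg_iff_add_eq_0 add.commute)
    have "s * norm v = norm (s *\<^sub>R v)" using assms(2,3) by simp
    also have "\<dots> = t * norm (A *v v)" unfolding eq using t by simp
    also have "\<dots> \<le> norm (A *v v)" using t by (simp add: mult_left_le_one_le)
    also have "\<dots> \<le> L * norm v" by (rule assms(1))
    finally have "(s - L) * norm v \<le> 0" by (simp add: algebra_simps)
    then show "v = 0" using assms(2) by (simp add: mult_le_0_iff)
  qed
  then show ?thesis by (simp add: add.commute)
qed

text \<open>Solving y = s x + h x amounts to finding a fixed point of x -> (y - h x) / s, a
  contraction with constant L / s.\<close>

lemma bij_scaled_identity_plus_lipschitz: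
  fixes h :: "'a::banach \<Rightarrow> 'a"
  assumes lip: "L-lipschitz_on UNIV h" and s: "s > L"
  shows "bij (\<lambda>x. s *\<^sub>R x + h x)"
proof -
  have L: "L \<ge> 0" using lip by (rule lipschitz_on_nonneg)
  have "\<exists>!x. (y - h x) /\<^sub>R s = x" for y
  proof (rule banach_fix_type)
    show "0 \<le> L / s" "L / s < 1" using L s by auto
    show "\<forall>x z. dist ((y - h x) /\<^sub>R s) ((y - h z) /\<^sub>R s) \<le> L / s * dist x z"
    proof (intro allI)
      fix x z
      have "dist ((y - h x) /\<^sub>R s) ((y - h z) /\<^sub>R s) = dist (h z) (h x) / s"
        using L s by (simp add: dist_norm scaleR_diff_right[symmetric] divide_inverse)
      also have "\<dots> \<le> L * dist x z / s"
        using lipschitz_onD[OF lip, of z x] L s by (intro divide_right_mono) (auto simp: dist_commute)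
      finally show "dist ((y - h x) /\<^sub>R s) ((y - h z) /\<^sub>R s) \<le> L / s * dist x z" by simp
    qed
  qed
  moreover have "(y - h x) /\<^sub>R s = x \<longleftrightarrow> y = s *\<^sub>R x + h x" for x y
  proof -
    have "(y - h x) /\<^sub>R s = x \<longleftrightarrow> s *\<^sub>R ((y - h x) /\<^sub>R s) = s *\<^sub>R x"
      using L s by (subst scaleR_cancel_left) simp
    also have "s *\<^sub>R ((y - h x) /\<^sub>R s) = y - h x"
      using L s by simp
    finally show ?thesis by (simp add: diff_eq_eq)
  qed
  ultimately have "\<exists>!x. y = s *\<^sub>R x + h x" for y by simp
  then show ?thesis by (simp add: bij_iff eq_commute)
qed

text \<open>For s > L the map s x + h x is injective with positive Jacobian determinant, so the
  change of variables formula holds without absolute value and the integral is the volume of the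
  image. Deleting N does not change this volume, because Lipschitz maps send negligible sets to
  negligible sets.\<close>

lemma has_integral_det_scaled_identity_plus:
  fixes h :: "real^'n::{finite,wellorder} \<Rightarrow> real^'n::_"
  assumes lip: "L-lipschitz_on UNIV h" and s: "s > L" and B: "compact B" and N: "negligible N"
    and der: "\<And>x. x \<in> B - N \<Longrightarrow> (h has_derivative (*v) (h' x)) (at x)"
  shows "((\<lambda>x. det (s *\<^sub>R mat 1 + h' x)) has_integral measure lebesgue ((\<lambda>x. s *\<^sub>R x + h x) ` B)) (B - N)"
proof -
  define f where "f = (\<lambda>x. s *\<^sub>R x + h x)"
  have L: "L \<ge> 0" using lip by (rule lipschitz_on_nonneg)
  have lipf: "(s + L)-lipschitz_on UNIV f"
    unfolding f_def using lipschitz_on_cmult_nonneg[OF lipschitz_on_id, of s UNIV] L s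
    by (intro lipschitz_on_add lip) simp
  have "continuous_on B f"
    using lipschitz_on_continuous_on lipf continuous_on_subset by blast
  then have fB: "f ` B \<in> lmeasurable"
    using B compact_continuous_image lmeasurable_compact by blast
  have "negligible (f ` (B \<inter> N))"
  proof (rule negligible_locally_Lipschitz_image)
    fix x assume "x \<in> B \<inter> N"
    show "\<exists>T C. open T \<and> x \<in> T \<and> (\<forall>y\<in>B \<inter> N \<inter> T. norm (f y - f x) \<le> C * norm (y - x))"
      using lipschitz_on_normD[OF lipf] by (intro exI[of _ UNIV] exI[of _ "s + L"]) auto
  next
    show "negligible (B \<inter> N)" by (rule negligible_subset[OF N]) blast
  qed simp
  then have neg: "negligible (f ` B - f ` (B - N) \<union> (f ` (B - N) - f ` B))"
    by (rule negligible_subset) auto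
  have "f ` (B - N) \<in> lmeasurable \<and> measure lebesgue (f ` (B - N)) = measure lebesgue (f ` B)"
    using fB neg lmeasurable_negligible_symdiff measure_negligible_symdiff by blast
  moreover have "f ` (B - N) \<in> lmeasurable \<and> measure lebesgue (f ` (B - N)) = measure lebesgue (f ` B)
      \<longleftrightarrow> ((\<lambda>x. \<bar>det (matrix ((*v) (s *\<^sub>R mat 1 + h' x)))\<bar>) has_integral measure lebesgue (f ` B)) (B - N)"
  proof (rule has_measure_differentiable_image)
    show "B - N \<in> sets lebesgue"
      using B N by (auto intro: lmeasurable_compact fmeasurableD negligible_imp_sets)
    show "inj_on f (B - N)"
      using bij_scaled_identity_plus_lipschitz[OF lip s] unfolding f_def bij_def by (meson inj_on_subset subset_UNIV)
    fix x assume "x \<in> B - N"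
    have "(\<lambda>v. s *\<^sub>R v + h' x *v v) = (*v) (s *\<^sub>R mat 1 + h' x)"
      by (auto simp: fun_eq_iff matrix_vector_mult_add_rdistrib scaleR_matrix_vector_assoc[symmetric])
    moreover have "(f has_derivative (\<lambda>v. s *\<^sub>R v + h' x *v v)) (at x within B - N)"
      unfolding f_def using der[OF \<open>x \<in> B - N\<close>]
      by (intro has_derivative_add has_derivative_scaleR_right has_derivative_ident) (rule has_derivative_at_withinI)
    ultimately show "(f has_derivative (*v) (s *\<^sub>R mat 1 + h' x)) (at x within B - N)"
      by simp
  qed
  ultimately have int: "((\<lambda>x. \<bar>det (s *\<^sub>R mat 1 + h' x)\<bar>) has_integral measure lebesgue (f ` B)) (B - N)"
    by simp
  have abs_det: "\<bar>det (s *\<^sub>R mat 1 + h' x)\<bar> = det (s *\<^sub>R mat 1 + h' x)" if "x \<in> B - N" for x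
    using det_scaled_identity_plus_pos[OF has_derivative_lipschitz_norm_le[OF lip der[OF that]] s L] by simp
  from int show ?thesis
    unfolding f_def by (rule has_integral_eq[rotated]) (rule abs_det)
qed

text \<open>The images of \<open>B\<close> under \<open>s x + h x\<close> and \<open>s x + k x\<close> are complements of the same set, so
  \<open>det (s I + Dh)\<close> and \<open>det (s I + Dk)\<close> have equal integrals for all large \<open>s\<close>; both sides are
  polynomials in \<open>s\<close>.\<close>

lemma has_integral_det_derivative_cong:
  fixes h k :: "real^'n::{finite,wellorder} \<Rightarrow> real^'n::_"
  assumes lip: "L-lipschitz_on UNIV h" "L-lipschitz_on UNIV k"
    and B: "compact B" and N: "negligible N"
    and der: "\<And>x. x \<in> B - N \<Longrightarrow> (h has_derivative (*v) (h' x)) (at x)"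
      "\<And>x. x \<in> B - N \<Longrightarrow> (k has_derivative (*v) (k' x)) (at x)"
    and eq: "\<And>x. x \<notin> B \<Longrightarrow> h x = k x"
  shows "\<exists>I. ((\<lambda>x. det (h' x)) has_integral I) (B - N) \<and> ((\<lambda>x. det (k' x)) has_integral I) (B - N)"
proof -
  obtain c where c: "\<And>p. degree p \<le> CARD('n) \<Longrightarrow>
      poly p 0 = (\<Sum>j\<le>CARD('n). c j * poly p ((L + 1) * real (Suc j)))"
    using poly_extrapolation_at_0 by blast
  \<comment> \<open>A fixed combination of the determinants of s I + A at s = L + 1, 2 (L + 1), ...;
    the spacing L + 1 keeps every sample point above L.\<close>
  have det0: "det A = (\<Sum>j\<le>CARD('n). c j * det (((L + 1) * real (Suc j)) *\<^sub>R mat 1 + A))"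
    for A :: "real^'n::_^'n::_"
    using det_matrix_pencil_poly[of "mat 1" A] c by fastforce
  have L: "L \<ge> 0" using lip(1) by (rule lipschitz_on_nonneg)
  have s: "(L + 1) * real (Suc j) > L" for j
  proof -
    have "L + 1 \<le> (L + 1) * real (Suc j)" using L by simp
    then show ?thesis by linarith
  qed
  define m where "m j = measure lebesgue ((\<lambda>x. ((L + 1) * real (Suc j)) *\<^sub>R x + h x) ` B)" for j
  have im: "(\<lambda>x. ((L + 1) * real (Suc j)) *\<^sub>R x + k x) ` B = (\<lambda>x. ((L + 1) * real (Suc j)) *\<^sub>R x + h x) ` B"
    (is "?k ` B = ?h ` B") for j
  proof -
    have "?k ` B = - ?k ` (- B)" "?h ` B = - ?h ` (- B)"
      using bij_scaled_identity_plus_lipschitz[OF lip(2) s, of j]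
        bij_scaled_identity_plus_lipschitz[OF lip(1) s, of j]
      by (simp_all add: bij_image_Compl_eq)
    moreover have "?k ` (- B) = ?h ` (- B)"
      using eq by (intro image_cong) auto
    ultimately show ?thesis by simp
  qed
  have "((\<lambda>x. det (h' x)) has_integral (\<Sum>j\<le>CARD('n). c j * m j)) (B - N)"
    unfolding det0[of "h' _"] m_def
    by (intro has_integral_sum has_integral_mult_right has_integral_det_scaled_identity_plus[OF lip(1) s B N der(1)]) auto
  moreover have "((\<lambda>x. det (k' x)) has_integral (\<Sum>j\<le>CARD('n). c j * m j)) (B - N)"
    unfolding det0[of "k' _"] m_def im[symmetric]
    by (intro has_integral_sum has_integral_mult_right has_integral_det_scaled_identity_plus[OF lip(2) s B N der(2)]) auto
  ultimately show ?thesis by blast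
qed


section \<open>Metrically regular piecewise affine maps\<close>

lemma det_nz_if_surj:
  fixes A :: "real^'n^'n"
  assumes "surj ((*v) A)"
  shows "det A \<noteq> 0"
  using linear_surjective_imp_injective[OF matrix_vector_mul_linear assms] det_nz_iff_inj[of "(*v) A"]
  by simp

text \<open>Only the instance x = a of the estimate is used: if c |y - P a| < e, some solution of P
  z = y lies closer to a than e.\<close>

lemma metrically_regular_at_imp_open_in_point:
  assumes "metrically_regular_at P a" and "e > 0"
  obtains \<delta> where "\<delta> > 0" "ball (P a) \<delta> \<subseteq> P ` ball a e"
proof -
  obtain c U V where c: "c > 0" and U: "a \<in> interior U" and V: "P a \<in> interior V"
    and reg: "\<And>x y. x \<in> U \<Longrightarrow> y \<in> V \<Longrightarrow> set_distance x (P -` {y}) \<le> ennreal (c * norm (y - P x))"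
    using assms(1) unfolding metrically_regular_at_def by blast
  obtain r where r: "r > 0" "ball (P a) r \<subseteq> V"
    using V by (meson mem_interior)
  show thesis
  proof
    show "min r (e / c) > 0" using r c assms(2) by simp
    show "ball (P a) (min r (e / c)) \<subseteq> P ` ball a e"
    proof
      fix y assume y: "y \<in> ball (P a) (min r (e / c))"
      have "c * norm (y - P a) < e"
        using y c by (simp add: dist_norm norm_minus_commute field_simps)
      moreover have "set_distance a (P -` {y}) \<le> ennreal (c * norm (y - P a))"
        using y r U interior_subset by (intro reg) auto
      ultimately have "set_distance a (P -` {y}) < ennreal e"
        using assms(2) by (metis ennreal_lessI le_less_trans)
      \<comment> \<open>The distance to an empty fibre is infinite, so the strict inequality also
        shows that P z = y has a solution.\<close>
      then obtain z where "P z = y" "ennreal (dist a z) < ennreal e"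
        unfolding set_distance_def by (auto simp: INF_less_iff)
      then show "y \<in> P ` ball a e"
        by (auto simp: ennreal_less_iff)
    qed
  qed
qed

section \<open>Affine pieces and the hyperplanes where they coincide\<close>

type_synonym 'n affine = "(real^'n^'n) \<times> (real^'n)"

definition affine_map :: "'n affine \<Rightarrow> real^'n \<Rightarrow> real^'n" where
  "affine_map C x = fst C *v x + snd C"

lemma affine_map_diff: "affine_map C x - affine_map C y = fst C *v (x - y)"
  by (simp add: affine_map_def matrix_vector_mult_diff_distrib)

lemma continuous_on_affine_map [continuous_intros]:
  "continuous_on S f \<Longrightarrow> continuous_on S (\<lambda>x. affine_map C (f x))"
  unfolding affine_map_def
  by (intro continuous_on_add continuous_on_const
      bounded_linear.continuous_on[OF matrix_vector_mul_bounded_linear])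

lemma has_derivative_affine_map:
  "(affine_map C has_derivative (*v) (fst C)) (at x)"
proof -
  have "((\<lambda>x. fst C *v x) has_derivative (*v) (fst C)) (at x)"
    by (intro linear_imp_has_derivative) simp
  from has_derivative_add[OF this has_derivative_const[of "snd C"]] show ?thesis
    by (simp add: affine_map_def[abs_def])
qed

text \<open>If the linear parts differ in row i, the i-th component of the equation is a nontrivial
  linear equation in x. If they are equal, the two maps never agree and any nonzero normal
  serves.\<close>

lemma affine_coincidence_hyperplane:
  fixes C D :: "'n::finite affine"
  assumes "C \<noteq> D"
  shows "\<exists>a b. a \<noteq> 0 \<and> (\<forall>x. affine_map C x = affine_map D x \<longrightarrow> a \<bullet> x = b)"
proof (cases "fst C = fst D")
  case True
  then have "affine_map C x \<noteq> affine_map D x" for x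
    using assms by (simp add: affine_map_def prod_eq_iff)
  then show ?thesis
    by (intro exI[of _ "axis undefined 1"]) (auto simp: axis_eq_0_iff)
next
  case False
  then obtain i where i: "fst C $ i \<noteq> fst D $ i"
    by (auto simp: vec_eq_iff)
  have "(fst C $ i - fst D $ i) \<bullet> x = snd D $ i - snd C $ i" if "affine_map C x = affine_map D x" for x
  proof -
    have "affine_map C x $ i = affine_map D x $ i" using that by simp
    then show ?thesis
      by (simp add: affine_map_def matrix_vector_mul_component inner_diff_left)
  qed
  with i show ?thesis
    by (intro exI[of _ "fst C $ i - fst D $ i"]) auto
qed

text \<open>Outside these hyperplanes the pieces have pairwise distinct values, so a continuous
  selection cannot change its piece there.\<close>

lemma affine_coincidence_hyperplanes:
  fixes \<A> :: "'n::finite affine set"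
  assumes "finite \<A>"
  obtains \<H> :: "((real^'n) \<times> real) set" where "finite \<H>" "\<And>a b. (a, b) \<in> \<H> \<Longrightarrow> a \<noteq> 0"
    "\<And>C D x. C \<in> \<A> \<Longrightarrow> D \<in> \<A> \<Longrightarrow> C \<noteq> D \<Longrightarrow> affine_map C x = affine_map D x \<Longrightarrow>
      \<exists>(a, b)\<in>\<H>. a \<bullet> x = b"
proof -
  have "\<exists>h. fst p \<noteq> snd p \<longrightarrow> fst h \<noteq> 0 \<and>
      (\<forall>x. affine_map (fst p) x = affine_map (snd p) x \<longrightarrow> fst h \<bullet> x = snd h)"
    for p :: "'n affine \<times> 'n affine"
  proof (cases "fst p = snd p")
    case False
    from affine_coincidence_hyperplane[OF this] obtain a b where
      "a \<noteq> 0 \<and> (\<forall>x. affine_map (fst p) x = affine_map (snd p) x \<longrightarrow> a \<bullet> x = b)"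
      by blast
    then show ?thesis by (intro exI[of _ "(a, b)"]) simp
  qed simp
  then obtain h :: "'n affine \<times> 'n affine \<Rightarrow> (real^'n) \<times> real"
    where h: "\<And>p. fst p \<noteq> snd p \<Longrightarrow> fst (h p) \<noteq> 0 \<and>
      (\<forall>x. affine_map (fst p) x = affine_map (snd p) x \<longrightarrow> fst (h p) \<bullet> x = snd (h p))"
    by metis
  show thesis
  proof (rule that)
    show "finite (h ` {p \<in> \<A> \<times> \<A>. fst p \<noteq> snd p})"
      by (intro finite_imageI finite_subset[OF _ finite_cartesian_product[OF assms assms]]) blast
    show "a \<noteq> 0" if ab: "(a, b) \<in> h ` {p \<in> \<A> \<times> \<A>. fst p \<noteq> snd p}" for a b
    proof -
      obtain p where "fst p \<noteq> snd p" "h p = (a, b)"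
        using ab by (metis (mono_tags, lifting) imageE mem_Collect_eq)
      with h[of p] show ?thesis by simp
    qed
    show "\<exists>(a, b)\<in>h ` {p \<in> \<A> \<times> \<A>. fst p \<noteq> snd p}. a \<bullet> x = b"
      if "C \<in> \<A>" "D \<in> \<A>" "C \<noteq> D" "affine_map C x = affine_map D x" for C D x
      using that h[of "(C, D)"] by (intro bexI[of _ "h (C, D)"]) (auto simp: case_prod_beta)
  qed
qed

text \<open>Both sides are continuous and agree at x - t a for small t > 0, which lies in the open
  half; then t tends to 0.\<close>

lemma affine_on_closed_halfball:
  assumes cont: "continuous_on UNIV P" and a: "a \<noteq> 0"
    and half: "\<And>x. x \<in> ball z e \<Longrightarrow> a \<bullet> (x - z) < 0 \<Longrightarrow> P x = affine_map C x"
    and x: "x \<in> ball z e" "a \<bullet> (x - z) \<le> 0"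
  shows "P x = affine_map C x"
proof (rule tendsto_unique)
  have lim: "((\<lambda>t. x - t *\<^sub>R a) \<longlongrightarrow> x) (at_right 0)"
    by (auto intro!: tendsto_eq_intros)
  have "isCont P x" using cont by (simp add: continuous_on_eq_continuous_at)
  then show "((\<lambda>t. P (x - t *\<^sub>R a)) \<longlongrightarrow> P x) (at_right 0)"
    using lim isCont_tendsto_compose by blast
  have "isCont (affine_map C) x"
    using has_derivative_affine_map has_derivative_continuous by blast
  then have "((\<lambda>t. affine_map C (x - t *\<^sub>R a)) \<longlongrightarrow> affine_map C x) (at_right 0)"
    using lim isCont_tendsto_compose by blast
  moreover have "\<forall>\<^sub>F t in at_right 0. affine_map C (x - t *\<^sub>R a) = P (x - t *\<^sub>R a)"
  proof -
    have "\<forall>\<^sub>F t in at_right 0. x - t *\<^sub>R a \<in> ball z e"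
      using lim x(1) by (rule topological_tendstoD[OF _ open_ball])
    moreover have "\<forall>\<^sub>F t in at_right (0::real). t > 0"
      by (rule eventually_at_right_less)
    ultimately show ?thesis
    proof eventually_elim
      case (elim t)
      have "a \<bullet> (x - t *\<^sub>R a - z) = a \<bullet> (x - z) - t * (a \<bullet> a)"
        by (simp add: inner_diff_right)
      also have "\<dots> < 0"
        using elim x(2) a by (smt (verit) inner_gt_zero_iff mult_pos_pos)
      finally show ?case using half[OF elim(1)] by simp
    qed
  qed
  ultimately show "((\<lambda>t. P (x - t *\<^sub>R a)) \<longlongrightarrow> affine_map C x) (at_right 0)"
    by (rule Lim_transform_eventually)
qed simp

text \<open>\<open>A\<^sub>1\<inverse> A\<^sub>2\<close> is the rank one perturbation \<open>v + (a \<bullet> v) w\<close> of the identity. If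
  \<open>1 + a \<bullet> w\<close> were not positive, both halves of the ball would be mapped to the same side of a
  hyperplane.\<close>

lemma det_sign_across_hyperplane:
  fixes P :: "real^'n \<Rightarrow> real^'n"
  assumes cont: "continuous_on UNIV P" and a: "a \<noteq> 0" and e: "e > 0"
    and below: "\<And>x. x \<in> ball z e \<Longrightarrow> a \<bullet> (x - z) < 0 \<Longrightarrow> P x = affine_map C\<^sub>1 x"
    and above: "\<And>x. x \<in> ball z e \<Longrightarrow> a \<bullet> (x - z) > 0 \<Longrightarrow> P x = affine_map C\<^sub>2 x"
    and reg: "metrically_regular_at P z" and nz: "det (fst C\<^sub>1) \<noteq> 0"
  shows "det (fst C\<^sub>1) * det (fst C\<^sub>2) > 0"
proof -
  define A\<^sub>1 A\<^sub>2 where "A\<^sub>1 = fst C\<^sub>1" and "A\<^sub>2 = fst C\<^sub>2"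
  have P1: "P x = affine_map C\<^sub>1 x" if "x \<in> ball z e" "a \<bullet> (x - z) \<le> 0" for x
    using affine_on_closed_halfball[OF cont a below] that by blast
  have P2: "P x = affine_map C\<^sub>2 x" if "x \<in> ball z e" "a \<bullet> (x - z) \<ge> 0" for x
    using affine_on_closed_halfball[OF cont, of "- a" z e C\<^sub>2 x] a above that by simp
  have z: "z \<in> ball z e" using e by simp
  have Pz: "P z = affine_map C\<^sub>1 z" "P z = affine_map C\<^sub>2 z"
    using P1[OF z] P2[OF z] by auto
  have agree: "A\<^sub>1 *v v = A\<^sub>2 *v v" if v: "a \<bullet> v = 0" for v
  proof (cases "v = 0")
    case False
    define t where "t = e / 2 / norm v"
    have "z + t *\<^sub>R v \<in> ball z e" "t \<noteq> 0"
      using False e by (auto simp: t_def dist_norm)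
    with v have "affine_map C\<^sub>1 (z + t *\<^sub>R v) = affine_map C\<^sub>2 (z + t *\<^sub>R v)"
      using P1[of "z + t *\<^sub>R v"] P2[of "z + t *\<^sub>R v"] by simp
    then have "A\<^sub>1 *v (t *\<^sub>R v) = A\<^sub>2 *v (t *\<^sub>R v)"
      using affine_map_diff[of C\<^sub>1 "z + t *\<^sub>R v" z] affine_map_diff[of C\<^sub>2 "z + t *\<^sub>R v" z] Pz
      by (simp add: A\<^sub>1_def A\<^sub>2_def)
    with \<open>t \<noteq> 0\<close> show ?thesis by (simp add: matrix_vector_mult_scaleR)
  qed simp
  obtain M where M: "A\<^sub>1 ** M = mat 1" "M ** A\<^sub>1 = mat 1"
    using nz unfolding A\<^sub>1_def invertible_det_nz[symmetric] invertible_def by blast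
  have MA: "M *v (A\<^sub>1 *v v) = v" for v
    by (simp add: matrix_vector_mul_assoc M)
  define B where "B = M ** A\<^sub>2"
  \<comment> \<open>By \<open>agree\<close>, B fixes every vector orthogonal to a, so it is
    determined by its value at a; w is chosen such that B a = a + (a \<bullet> a) w.\<close>
  define w where "w = (1 / (a \<bullet> a)) *\<^sub>R (M *v ((A\<^sub>2 - A\<^sub>1) *v a))"
  have Bv: "B *v v = v + (a \<bullet> v) *\<^sub>R w" for v
  proof -
    define u where "u = v - (a \<bullet> v / (a \<bullet> a)) *\<^sub>R a"
    have u: "a \<bullet> u = 0" using a by (simp add: u_def inner_diff_right)
    have v: "v = u + (a \<bullet> v / (a \<bullet> a)) *\<^sub>R a" by (simp add: u_def)
    have "B *v v = M *v (A\<^sub>2 *v u) + (a \<bullet> v / (a \<bullet> a)) *\<^sub>R (M *v (A\<^sub>2 *v a))"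
      by (subst v) (simp add: B_def matrix_vector_mul_assoc[symmetric] matrix_vector_right_distrib matrix_vector_mult_scaleR)
    also have "M *v (A\<^sub>2 *v u) = u" using agree[OF u] MA by metis
    also have "M *v (A\<^sub>2 *v a) = a + (a \<bullet> a) *\<^sub>R w"
      using a by (simp add: w_def matrix_vector_mult_diff_distrib matrix_vector_mult_diff_rdistrib MA)
    finally show ?thesis using a by (simp add: u_def algebra_simps)
  qed
  have side: "1 + a \<bullet> w > 0"
  proof (rule ccontr)
    assume neg: "\<not> 1 + a \<bullet> w > 0"
    obtain \<delta> where \<delta>: "\<delta> > 0" "ball (P z) \<delta> \<subseteq> P ` ball z e"
      using metrically_regular_at_imp_open_in_point[OF reg e] by blast
    \<comment> \<open>The target is the value of the first piece at z + t a, a point on the side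
      where that piece is not in force. The choice of t keeps it within \<delta> of P z, and the
      summand 1 avoids division by zero.\<close>
    define t where "t = \<delta> / 2 / (norm (A\<^sub>1 *v a) + 1)"
    have t: "t > 0" using \<delta> by (simp add: t_def add_nonneg_pos)
    have "norm (t *\<^sub>R (A\<^sub>1 *v a)) < \<delta>"
    proof -
      have "norm (t *\<^sub>R (A\<^sub>1 *v a)) = \<delta> / 2 * (norm (A\<^sub>1 *v a) / (norm (A\<^sub>1 *v a) + 1))"
        using t \<delta>(1) by (simp add: t_def)
      also have "\<dots> \<le> \<delta> / 2 * 1"
        using \<delta>(1) by (intro mult_left_mono) (simp_all add: divide_le_eq_1_pos add_nonneg_pos)
      finally show ?thesis using \<delta> by simp
    qed
    then have "P z + t *\<^sub>R (A\<^sub>1 *v a) \<in> ball (P z) \<delta>" by (simp add: dist_norm)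
    with \<delta> obtain x where x: "x \<in> ball z e" "P x = P z + t *\<^sub>R (A\<^sub>1 *v a)" by fastforce
    have taa: "t * (a \<bullet> a) > 0" using t a by simp
    show False
    proof (cases "a \<bullet> (x - z) \<le> 0")
      case True
      then have "A\<^sub>1 *v (x - z) = A\<^sub>1 *v (t *\<^sub>R a)"
        using P1[OF x(1)] Pz(1) x(2) affine_map_diff[of C\<^sub>1 x z, folded A\<^sub>1_def]
        by (metis add_diff_cancel_left' matrix_vector_mult_scaleR)
      then have "x - z = t *\<^sub>R a" using MA by metis
      with True taa show False by simp
    next
      case False
      then have "A\<^sub>2 *v (x - z) = A\<^sub>1 *v (t *\<^sub>R a)"
        using P2[OF x(1)] Pz(2) x(2) affine_map_diff[of C\<^sub>2 x z, folded A\<^sub>2_def]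
        by (metis add_diff_cancel_left' linorder_linear matrix_vector_mult_scaleR)
      then have "B *v (x - z) = t *\<^sub>R a"
        unfolding B_def matrix_vector_mul_assoc[symmetric] by (simp only: MA)
      then have "a \<bullet> (x - z + (a \<bullet> (x - z)) *\<^sub>R w) = t * (a \<bullet> a)"
        unfolding Bv by simp
      then have "(a \<bullet> (x - z)) * (1 + a \<bullet> w) > 0"
        using taa by (simp add: inner_add_right algebra_simps)
      with False neg show False by (simp add: zero_less_mult_iff)
    qed
  qed
  \<comment> \<open>A kernel vector v of I + t (B - I) satisfies (a \<bullet> v) (1 + t (a \<bullet>
    w)) = 0, and 1 + t (a \<bullet> w) is a convex combination of the positive numbers 1 and 1 + a
    \<bullet> w.\<close>
  have "det (B - mat 1 + mat 1) > 0"
  proof (rule det_pos_along_segment)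
    fix t v assume t: "0 \<le> t" "t \<le> (1::real)"
      and eq: "t *\<^sub>R ((B - mat 1) *v v) + mat 1 *v v = 0"
    have eq': "v + (t * (a \<bullet> v)) *\<^sub>R w = 0"
      using eq by (simp add: matrix_vector_mult_diff_rdistrib Bv add.commute)
    then have "a \<bullet> (v + (t * (a \<bullet> v)) *\<^sub>R w) = 0" by simp
    then have "(a \<bullet> v) * (1 + t * (a \<bullet> w)) = 0"
      by (simp add: inner_add_right algebra_simps)
    moreover have "1 + t * (a \<bullet> w) > 0"
    proof -
      have "1 + t * (a \<bullet> w) = (1 - t) + t * (1 + a \<bullet> w)" by (simp add: algebra_simps)
      also have "\<dots> > 0"
        using t side by (cases "t = 1") (auto intro: add_pos_nonneg)
      finally show ?thesis .
    qed
    ultimately have "a \<bullet> v = 0" by simp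
    with eq' show "v = 0" by simp
  qed simp
  then have B: "det B > 0" by simp
  have "A\<^sub>2 = A\<^sub>1 ** B" by (simp add: B_def matrix_mul_assoc M)
  then have "det A\<^sub>2 = det A\<^sub>1 * det B" by (simp add: det_mul)
  then have "det A\<^sub>1 * det A\<^sub>2 = (det A\<^sub>1)\<^sup>2 * det B" by (simp add: power2_eq_square)
  with B nz show ?thesis by (simp add: A\<^sub>1_def A\<^sub>2_def)
qed

section \<open>Continuous selections with a hyperplane arrangement\<close>

text \<open>No decomposition into polyhedra is recorded; the complement of the finitely many
  hyperplanes plays that role.\<close>

locale piecewise_affine =
  fixes P :: "real^'n::finite \<Rightarrow> real^'n" and \<A> :: "'n affine set"
    and \<H> :: "((real^'n) \<times> real) set" and L :: real
  assumes finite_pieces: "finite \<A>"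
    and selection: "\<exists>C\<in>\<A>. P x = affine_map C x"
    and lipschitz: "L-lipschitz_on UNIV P"
    and finite_hyperplanes: "finite \<H>"
    and normal_nonzero: "(a, b) \<in> \<H> \<Longrightarrow> a \<noteq> 0"
    and coincidence: "\<lbrakk>C \<in> \<A>; D \<in> \<A>; C \<noteq> D; affine_map C x = affine_map D x\<rbrakk> \<Longrightarrow>
      \<exists>(a, b)\<in>\<H>. a \<bullet> x = b"
begin

text \<open>An upper bound for the set of nonsmooth points: the hyperplanes are taken in full, even
  where \<open>P\<close> happens to be affine across them.\<close>

definition kinks :: "(real^'n) set" where
  "kinks = (\<Union>(a, b)\<in>\<H>. {x. a \<bullet> x = b})"

lemma mem_kinks: "x \<in> kinks \<longleftrightarrow> (\<exists>(a, b)\<in>\<H>. a \<bullet> x = b)"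
  by (auto simp: kinks_def)

lemma closed_kinks: "closed kinks"
  unfolding kinks_def using finite_hyperplanes by (intro closed_UN) (auto simp: closed_hyperplane)

lemma negligible_kinks: "negligible kinks"
  unfolding kinks_def
  by (intro negligible_Union finite_imageI finite_hyperplanes)
    (auto intro!: negligible_hyperplane dest: normal_nonzero)

lemma continuous: "continuous_on S P"
  using lipschitz lipschitz_on_continuous_on continuous_on_subset by blast

text \<open>The sets where \<open>P\<close> follows a given piece are closed in S, finite in number
  and, off the hyperplanes, disjoint. Hence the one that contains x is clopen in the connected set S
  and is all of S.\<close>

lemma affine_off_kinks:
  assumes "connected S" "S \<inter> kinks = {}" "S \<noteq> {}"
  obtains C where "C \<in> \<A>" "\<And>x. x \<in> S \<Longrightarrow> P x = affine_map C x"
proof -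
  obtain x where x: "x \<in> S" using assms(3) by blast
  obtain C where C: "C \<in> \<A>" "P x = affine_map C x" using selection by blast
  define T where "T D = {y \<in> S. P y = affine_map D y}" for D
  have closed_T: "closedin (top_of_set S) (T D)" for D
  proof -
    have "closedin (top_of_set S) (S \<inter> (\<lambda>y. P y - affine_map D y) -` {0})"
      by (intro continuous_closedin_preimage continuous_intros continuous)
    moreover have "S \<inter> (\<lambda>y. P y - affine_map D y) -` {0} = T D"
      by (auto simp: T_def)
    ultimately show ?thesis by simp
  qed
  have "S - T C = (\<Union>D\<in>\<A> - {C}. T D)"
  proof (intro equalityI subsetI)
    fix y assume "y \<in> S - T C"
    with selection[of y] show "y \<in> (\<Union>D\<in>\<A> - {C}. T D)"
      by (auto simp: T_def)
  next
    fix y assume "y \<in> (\<Union>D\<in>\<A> - {C}. T D)"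
    then obtain D where D: "D \<in> \<A>" "D \<noteq> C" "y \<in> S" "P y = affine_map D y"
      by (auto simp: T_def)
    moreover have "P y \<noteq> affine_map C y"
      using coincidence[of C D y] C(1) D assms(2) mem_kinks[of y] by auto
    ultimately show "y \<in> S - T C" by (auto simp: T_def)
  qed
  moreover have "closedin (top_of_set S) (\<Union>D\<in>\<A> - {C}. T D)"
    using finite_pieces closed_T by (intro closedin_Union) auto
  ultimately have "openin (top_of_set S) (T C)"
    by (metis (no_types, lifting) Diff_Diff_Int T_def closedin_def inf.absorb_iff2 mem_Collect_eq subsetI topspace_euclidean_subtopology)
  then have "T C = {} \<or> T C = S"
    using assms(1) closed_T connected_clopen by blast
  moreover have "x \<in> T C" using x C by (simp add: T_def)
  ultimately have "T C = S" by blast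
  then have "P y = affine_map C y" if "y \<in> S" for y
    using that unfolding T_def by blast
  with C(1) show thesis by (rule that)
qed

text \<open>Meaningful where \<open>P\<close> is differentiable, in particular off
  \<open>kinks\<close>; elsewhere the value is arbitrary.\<close>

definition jacobian :: "real^'n \<Rightarrow> real^'n^'n" where
  "jacobian x = matrix (frechet_derivative P (at x))"

lemma affine_piece_derivative:
  assumes "open S" "x \<in> S" "\<And>y. y \<in> S \<Longrightarrow> P y = affine_map C y"
  shows "(P has_derivative (*v) (fst C)) (at x)" "jacobian x = fst C"
proof -
  show der: "(P has_derivative (*v) (fst C)) (at x)"
    using has_derivative_transform_within_open[OF has_derivative_affine_map assms(1,2)] assms(3) by simp
  show "jacobian x = fst C"
    unfolding jacobian_def frechet_derivative_at[OF der, symmetric] by simp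
qed

lemma local_piece:
  assumes "x \<notin> kinks"
  obtains C e where "C \<in> \<A>" "e > 0" "ball x e \<inter> kinks = {}"
    "\<And>y. y \<in> ball x e \<Longrightarrow> P y = affine_map C y"
proof -
  have "open (- kinks)" using closed_kinks by (simp add: open_Compl)
  with assms obtain e where e: "e > 0" "ball x e \<subseteq> - kinks"
    by (metis ComplI open_contains_ball)
  then have "ball x e \<inter> kinks = {}" "ball x e \<noteq> {}" by auto
  with affine_off_kinks[OF connected_ball] that e show thesis by metis
qed

lemma has_derivative_jacobian:
  assumes "x \<notin> kinks"
  shows "(P has_derivative (*v) (jacobian x)) (at x)"
proof -
  obtain C e where "e > 0" and C: "\<And>y. y \<in> ball x e \<Longrightarrow> P y = affine_map C y"
    using local_piece[OF assms] by metis
  then have "x \<in> ball x e" by simp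
  from affine_piece_derivative[OF open_ball this C] show ?thesis by simp
qed

text \<open>Near x the map is a single affine piece, and openness at x makes the range of its linear
  part contain a ball around 0, hence every vector.\<close>

lemma det_jacobian_nonzero:
  assumes "x \<notin> kinks" "metrically_regular_at P x"
  shows "det (jacobian x) \<noteq> 0"
proof -
  obtain C e where e: "e > 0" and C: "\<And>y. y \<in> ball x e \<Longrightarrow> P y = affine_map C y"
    using local_piece[OF assms(1)] by metis
  have x: "x \<in> ball x e" using e by simp
  obtain \<delta> where \<delta>: "\<delta> > 0" "ball (P x) \<delta> \<subseteq> P ` ball x e"
    using metrically_regular_at_imp_open_in_point[OF assms(2) e] by blast
  have "\<exists>v. w = fst C *v v" for w
  proof (cases "w = 0")
    case True
    then show ?thesis by (intro exI[of _ 0]) simp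
  next
    case False
    define t where "t = \<delta> / 2 / norm w"
    have t: "t \<noteq> 0" using False \<delta>(1) by (simp add: t_def)
    have "P x + t *\<^sub>R w \<in> ball (P x) \<delta>"
      using False \<delta>(1) by (simp add: t_def dist_norm)
    with \<delta>(2) obtain y where y: "y \<in> ball x e" "P y = P x + t *\<^sub>R w" by (metis imageE subsetD)
    then have "t *\<^sub>R w = fst C *v (y - x)"
      using affine_map_diff[of C y x] C[OF x] C[OF y(1)] by simp
    then have "w = fst C *v (inverse t *\<^sub>R (y - x))"
      using t by (metis matrix_vector_mult_scaleR scaleR_one scaleR_scaleR left_inverse)
    then show ?thesis by blast
  qed
  then have "surj ((*v) (fst C))" by (auto simp: surj_def)
  then show ?thesis
    using det_nz_if_surj affine_piece_derivative(2)[OF open_ball x C] by simp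
qed

section \<open>Common sign of the Jacobian determinants\<close>

text \<open>Each open half-ball is connected and free of kinks, so it carries one piece, and the two
  pieces are compared by \<open>det_sign_across_hyperplane\<close>.\<close>

lemma crossing_two_pieces:
  assumes e: "e > 0" and a: "a \<noteq> 0"
    and K: "ball z e \<inter> kinks = ball z e \<inter> {w. a \<bullet> (w - z) = 0}"
    and reg: "\<And>w. w \<in> ball z e \<Longrightarrow> metrically_regular_at P w"
    and u: "u \<in> ball z e - kinks" and v: "v \<in> ball z e - kinks"
  shows "det (jacobian u) * det (jacobian v) > 0"
proof -
  define H where "H \<sigma> = ball z e \<inter> {w. \<sigma> *\<^sub>R a \<bullet> (w - z) > 0}" for \<sigma> :: real
  have H_open: "open (H \<sigma>)" for \<sigma>
    unfolding H_def by (intro open_Int open_ball open_Collect_less continuous_intros)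
  have H_ne: "H \<sigma> \<noteq> {}" if "\<sigma> = 1 \<or> \<sigma> = -1" for \<sigma>
  proof -
    have "z + (\<sigma> * e / 2 / norm a) *\<^sub>R a \<in> H \<sigma>"
      using e a that unfolding H_def by (auto simp: dist_norm)
    then show ?thesis by blast
  qed
  have "convex (H \<sigma>)" for \<sigma>
    unfolding H_def inner_diff_right
    using convex_Int[OF convex_ball convex_halfspace_gt[of "\<sigma> *\<^sub>R a \<bullet> z" "\<sigma> *\<^sub>R a"]]
    by (simp add: inner_diff_right)
  then have H_conn: "connected (H \<sigma>)" for \<sigma>
    by (rule convex_connected)
  have H_kinks: "H \<sigma> \<inter> kinks = {}" if "\<sigma> \<noteq> 0" for \<sigma>
  proof -
    have "H \<sigma> \<inter> kinks \<subseteq> ball z e \<inter> {w. a \<bullet> (w - z) = 0}"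
      using K unfolding H_def by blast
    then show ?thesis unfolding H_def by auto
  qed
  obtain C where C: "\<And>x. x \<in> H (-1) \<Longrightarrow> P x = affine_map C x"
    using affine_off_kinks[OF H_conn, of "-1"] H_kinks[of "-1"] H_ne[of "-1"]
    by (metis neg_equal_0_iff_equal zero_neq_one)
  obtain D where D: "\<And>x. x \<in> H 1 \<Longrightarrow> P x = affine_map D x"
    using affine_off_kinks[OF H_conn, of 1] H_kinks[of 1] H_ne[of 1] by (metis zero_neq_one)
  have JC: "jacobian w = fst C" if "w \<in> H (-1)" for w
    by (rule affine_piece_derivative(2)[OF H_open that C])
  have JD: "jacobian w = fst D" if "w \<in> H 1" for w
    by (rule affine_piece_derivative(2)[OF H_open that D])
  have nzJ: "det (jacobian w) \<noteq> 0" if "w \<in> H \<sigma>" "\<sigma> \<noteq> 0" for w \<sigma>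
  proof (rule det_jacobian_nonzero)
    show "w \<notin> kinks" using H_kinks that by blast
    show "metrically_regular_at P w" using reg that unfolding H_def by blast
  qed
  have nzC: "det (fst C) \<noteq> 0"
    using H_ne[of "-1"] nzJ[of _ "-1"] JC by (metis ex_in_conv neg_equal_0_iff_equal zero_neq_one)
  have CD: "det (fst C) * det (fst D) > 0"
  proof (rule det_sign_across_hyperplane[OF continuous a e _ _ _ nzC])
    show "P x = affine_map C x" if "x \<in> ball z e" "a \<bullet> (x - z) < 0" for x
      using that by (intro C) (simp add: H_def)
    show "P x = affine_map D x" if "x \<in> ball z e" "a \<bullet> (x - z) > 0" for x
      using that by (intro D) (simp add: H_def)
    show "metrically_regular_at P z" using e by (intro reg) simp
  qed
  have cover: "w \<in> H (-1) \<or> w \<in> H 1" if "w \<in> ball z e - kinks" for w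
  proof -
    have "w \<in> ball z e" "a \<bullet> (w - z) \<noteq> 0" using that K by blast+
    then show ?thesis by (auto simp: H_def)
  qed
  have "jacobian u = fst C \<or> jacobian u = fst D" "jacobian v = fst C \<or> jacobian v = fst D"
    using cover[OF u] cover[OF v] JC JD by blast+
  then show ?thesis
    using CD by (auto simp: zero_less_mult_iff)
qed

text \<open>Moving \<open>y\<close> off the hyperplanes with normals \<open>n h k\<close> through \<open>x\<close> ensures that the segment from
  \<open>x\<close> never meets two different hyperplanes at the same point, so that only the situation of
  \<open>crossing_two_pieces\<close> occurs along it.\<close>

lemma coherent_orientation:
  assumes reg: "\<And>w. w \<in> ball c r \<Longrightarrow> metrically_regular_at P w"
    and x: "x \<in> ball c r - kinks" and y: "y \<in> ball c r - kinks"
  shows "det (jacobian x) * det (jacobian y) > 0"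
proof -
  \<comment> \<open>With the gap g h = snd h - fst h \<bullet> x, the vector n h k is g k times the
    normal of h minus g h times the normal of k. If x + t d lies on both h and k, then t is nonzero
    because x lies on no hyperplane, and n h k \<bullet> d = 0 follows.\<close>
  define n where "n h k = (snd k - fst k \<bullet> x) *\<^sub>R fst h - (snd h - fst h \<bullet> x) *\<^sub>R fst k"
    for h k :: "(real^'n) \<times> real"
  \<comment> \<open>If n h k = 0, then h and k describe the same hyperplane, since neither contains
    x, and there is nothing to avoid.\<close>
  define B where "B h k = (if n h k = 0 then {} else {w. n h k \<bullet> w = n h k \<bullet> x})" for h k
  define bad where "bad = (\<Union>h\<in>\<H>. \<Union>k\<in>\<H>. B h k)"
  have "negligible (B h k)" for h k
    by (cases "n h k = 0") (simp_all add: B_def negligible_hyperplane)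
  then have "negligible (\<Union>k\<in>\<H>. B h k)" for h
    by (intro negligible_Union finite_imageI finite_hyperplanes) blast
  then have "negligible bad"
    unfolding bad_def by (intro negligible_Union finite_imageI finite_hyperplanes) blast
  obtain C e where e: "e > 0" "ball y e \<inter> kinks = {}" and C: "\<And>w. w \<in> ball y e \<Longrightarrow> P w = affine_map C w"
    using local_piece[of y] y by (metis DiffD2)
  have "open (ball y e \<inter> ball c r)" "y \<in> ball y e \<inter> ball c r" using e y by auto
  then have "\<not> ball y e \<inter> ball c r \<subseteq> bad"
    using \<open>negligible bad\<close> by (metis empty_iff negligible_subset open_not_negligible)
  then obtain y' where y': "y' \<in> ball y e" "y' \<in> ball c r" "y' \<notin> bad" by blast
  have yy: "jacobian y' = jacobian y"
  proof -
    have "y \<in> ball y e" using e(1) by simp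
    from affine_piece_derivative(2)[OF open_ball this C] affine_piece_derivative(2)[OF open_ball y'(1) C]
    show ?thesis by simp
  qed
  have y'k: "y' \<notin> kinks" using y' e by blast
  define S where "S = closed_segment x y'"
  have S: "S \<subseteq> ball c r"
    unfolding S_def using x y' by (intro closed_segment_subset) auto
  have Sp: "\<exists>t. z = x + t *\<^sub>R (y' - x)" if zS: "z \<in> S" for z
  proof -
    obtain t where "z = (1 - t) *\<^sub>R x + t *\<^sub>R y'" using zS unfolding S_def in_segment by blast
    then show ?thesis by (intro exI[of _ t]) (simp add: algebra_simps)
  qed
  \<comment> \<open>No hyperplane contains x, so each one meets S in at most one point.\<close>
  have fin: "finite (S \<inter> kinks)"
  proof -
    have "S \<inter> kinks \<subseteq> (\<lambda>(a, b). x + ((b - a \<bullet> x) / (a \<bullet> (y' - x))) *\<^sub>R (y' - x)) ` \<H>"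
    proof
      fix z assume z: "z \<in> S \<inter> kinks"
      then obtain a b where ab: "(a, b) \<in> \<H>" "a \<bullet> z = b" by (auto simp: mem_kinks)
      obtain t where t: "z = x + t *\<^sub>R (y' - x)" using Sp z by blast
      have "a \<bullet> x \<noteq> b" using ab x mem_kinks[of x] by blast
      moreover have "t * (a \<bullet> (y' - x)) = b - a \<bullet> x"
        using ab(2) by (simp add: t inner_add_right)
      ultimately have "t = (b - a \<bullet> x) / (a \<bullet> (y' - x))"
        by (auto simp: field_simps)
      with ab(1) t show "z \<in> (\<lambda>(a, b). x + ((b - a \<bullet> x) / (a \<bullet> (y' - x))) *\<^sub>R (y' - x)) ` \<H>"
        by force
    qed
    then show ?thesis by (rule finite_surj[OF finite_hyperplanes])
  qed
  have "det (jacobian x) * det (jacobian y') > 0"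
  \<comment> \<open>Agreement of signs is transitive. It holds among the points off
    \<open>kinks\<close> near each point of S, and such points are dense in S; connectedness of S
    then relates its two ends.\<close>
  proof (rule connected_equivalence_relation_gen[where S = S and P = "\<lambda>w. w \<notin> kinks"
        and R = "\<lambda>u v. det (jacobian u) * det (jacobian v) > 0"])
    show "connected S" "x \<in> S" "y' \<in> S" "x \<notin> kinks" "y' \<notin> kinks"
      using x y'k by (auto simp: S_def)
  next
    fix u v w assume "det (jacobian u) * det (jacobian v) > 0" "det (jacobian v) * det (jacobian w) > 0"
    then show "det (jacobian u) * det (jacobian w) > 0"
      by (auto simp: zero_less_mult_iff)
  next
    fix T z assume T: "openin (top_of_set S) T" "z \<in> T"
    show "\<exists>w. w \<in> T \<and> w \<notin> kinks"
    proof (cases "S = {x}")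
      case True
      have "T \<subseteq> S" using T(1) openin_imp_subset by blast
      with True T(2) x show ?thesis by blast
    next
      case False
      have "T \<subseteq> S" using T(1) openin_imp_subset by blast
      have "connected S" by (simp add: S_def)
      moreover have "S \<noteq> {z}" using False by (auto simp: S_def)
      ultimately have "z islimpt S"
        using connected_imp_perfect[of S z] T(2) \<open>T \<subseteq> S\<close> by blast
      then have "infinite T" using T infinite_openin by blast
      then have "\<not> T \<subseteq> S \<inter> kinks" using fin finite_subset by blast
      with \<open>T \<subseteq> S\<close> show ?thesis by blast
    qed
  next
    fix z assume z: "z \<in> S"
    show "\<exists>T. openin (top_of_set S) T \<and> z \<in> T \<and>
        (\<forall>u\<in>T. \<forall>v\<in>T. u \<notin> kinks \<and> v \<notin> kinks \<longrightarrow> det (jacobian u) * det (jacobian v) > 0)"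
    proof (cases "z \<in> kinks")
      case False
      then obtain D d where d: "d > 0" and off: "ball z d \<inter> kinks = {}"
          and D: "\<And>w. w \<in> ball z d \<Longrightarrow> P w = affine_map D w"
        using local_piece by metis
      have J: "jacobian u = fst D" if "u \<in> ball z d" for u
        by (rule affine_piece_derivative(2)[OF open_ball that D])
      have "det (jacobian z) \<noteq> 0"
        using det_jacobian_nonzero False reg S z by blast
      then have "det (fst D) \<noteq> 0" using J[of z] d by simp
      then show ?thesis
        using d z J by (intro exI[of _ "S \<inter> ball z d"]) (auto simp: openin_open_Int zero_less_mult_iff)
    next
      case True
      then obtain a b where ab: "(a, b) \<in> \<H>" "a \<bullet> z = b" by (auto simp: mem_kinks)
      \<comment> \<open>Every hyperplane through z lies in a \<bullet> w = b: both are met at the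
        same parameter t, and since y' is outside \<open>bad\<close>, the normals and the gaps must
        be proportional.\<close>
      have same: "a \<bullet> w = b" if h: "(a', b') \<in> \<H>" "a' \<bullet> z = b'" and w: "a' \<bullet> w = b'" for a' b' w
      proof -
        obtain t where t: "z = x + t *\<^sub>R (y' - x)" using Sp z by blast
        define \<gamma> \<gamma>' where "\<gamma> = b - a \<bullet> x" and "\<gamma>' = b' - a' \<bullet> x"
        have "\<gamma>' \<noteq> 0" using h x mem_kinks[of x] unfolding \<gamma>'_def by force
        have eqs: "t * (a \<bullet> (y' - x)) = \<gamma>" "t * (a' \<bullet> (y' - x)) = \<gamma>'"
          using ab(2) h(2) by (simp_all add: t inner_add_right \<gamma>_def \<gamma>'_def)
        with \<open>\<gamma>' \<noteq> 0\<close> have "t \<noteq> 0" by auto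
        have n: "n (a, b) (a', b') = \<gamma>' *\<^sub>R a - \<gamma> *\<^sub>R a'" by (simp add: n_def \<gamma>_def \<gamma>'_def)
        have "t * (n (a, b) (a', b') \<bullet> (y' - x)) = 0"
          unfolding n inner_diff_left inner_scaleR_left eqs[symmetric] by (simp add: algebra_simps)
        with \<open>t \<noteq> 0\<close> have "n (a, b) (a', b') \<bullet> y' = n (a, b) (a', b') \<bullet> x"
          by (simp add: inner_diff_right)
        moreover have "y' \<notin> B (a, b) (a', b')"
          using y'(3) ab(1) h(1) unfolding bad_def by blast
        ultimately have "n (a, b) (a', b') = 0"
          unfolding B_def by (metis mem_Collect_eq)
        then have "\<gamma>' * (a \<bullet> (w - x)) = \<gamma> * (a' \<bullet> (w - x))"
          unfolding n by (metis eq_iff_diff_eq_0 inner_scaleR_left)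
        also have "\<dots> = \<gamma> * \<gamma>'" using w by (simp add: \<gamma>'_def inner_diff_right)
        finally have "a \<bullet> (w - x) = \<gamma>" using \<open>\<gamma>' \<noteq> 0\<close> by simp
        then show ?thesis by (simp add: \<gamma>_def inner_diff_right)
      qed
      \<comment> \<open>The hyperplanes that miss z. A small ball around z avoids these finitely
        many closed sets, so only the one hyperplane through z remains in it.\<close>
      define far where "far = (\<Union>(a', b')\<in>{(a', b')\<in>\<H>. a' \<bullet> z \<noteq> b'}. {w. a' \<bullet> w = b'})"
      have "finite {(a', b')\<in>\<H>. a' \<bullet> z \<noteq> b'}"
        by (rule finite_subset[OF _ finite_hyperplanes]) blast
      then have "closed far"
        unfolding far_def by (intro closed_UN) (auto simp: closed_hyperplane)
      then have "open (- far \<inter> ball c r)" by (simp add: open_Compl open_Int)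
      moreover have "z \<in> - far \<inter> ball c r" using S z by (auto simp: far_def)
      ultimately obtain d where d: "d > 0" "ball z d \<subseteq> - far \<inter> ball c r"
        by (meson openE)
      have "ball z d \<inter> kinks = ball z d \<inter> {w. a \<bullet> (w - z) = 0}"
      proof (intro equalityI subsetI IntI)
        fix w assume w: "w \<in> ball z d \<inter> kinks"
        then obtain a' b' where h: "(a', b') \<in> \<H>" "a' \<bullet> w = b'" by (auto simp: mem_kinks)
        have "a' \<bullet> z = b'"
          using h w d(2) unfolding far_def by blast
        with same[OF h(1) this h(2)] ab(2) show "w \<in> {w. a \<bullet> (w - z) = 0}" by (simp add: inner_diff_right)
      next
        fix w assume "w \<in> ball z d \<inter> {w. a \<bullet> (w - z) = 0}"
        then have "a \<bullet> w = b" using ab(2) by (simp add: inner_diff_right)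
        with ab(1) show "w \<in> kinks" using mem_kinks by blast
      qed auto
      note two = crossing_two_pieces[OF d(1) normal_nonzero[OF ab(1)] this]
      have "det (jacobian u) * det (jacobian v) > 0"
        if "u \<in> ball z d - kinks" "v \<in> ball z d - kinks" for u v
        using two[OF _ that] reg d(2) by blast
      then show ?thesis
        using d(1) z by (intro exI[of _ "S \<inter> ball z d"]) (auto simp: openin_open_Int)
    qed
  qed
  then show ?thesis by (simp add: yy)
qed

section \<open>Isolation of solutions and linear growth\<close>

text \<open>At a kink, \<open>selection\<close> might yield a singular piece. But the points where
  \<open>P\<close> equals some nonsingular piece form a closed set that contains W minus the
  negligible set \<open>kinks\<close>, hence a dense part of W, hence all of W.\<close>

lemma nonsingular_piece:
  assumes W: "open W" "\<And>w. w \<in> W \<Longrightarrow> metrically_regular_at P w" and x: "x \<in> W"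
  obtains C where "C \<in> \<A>" "det (fst C) \<noteq> 0" "P x = affine_map C x"
proof -
  define K where "K = (\<Union>C\<in>{C\<in>\<A>. det (fst C) \<noteq> 0}. {y. P y = affine_map C y})"
  have "closed {y. P y = affine_map C y}" for C
    by (intro closed_Collect_eq continuous_intros continuous)
  then have "closed K"
    unfolding K_def using finite_pieces by (intro closed_UN) auto
  have sub: "W - kinks \<subseteq> K"
  proof
    fix y assume y: "y \<in> W - kinks"
    then obtain C e where C: "C \<in> \<A>" "e > 0" "\<And>w. w \<in> ball y e \<Longrightarrow> P w = affine_map C w"
      using local_piece by (metis DiffD2)
    then have "y \<in> ball y e" by simp
    from affine_piece_derivative(2)[OF open_ball this C(3)] det_jacobian_nonzero[of y] W(2)[of y] y
    have "det (fst C) \<noteq> 0" by auto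
    with C(1) C(3)[OF \<open>y \<in> ball y e\<close>] show "y \<in> K" unfolding K_def by blast
  qed
  have "x \<in> K"
  proof (rule ccontr)
    assume "x \<notin> K"
    moreover have "open (W - K)" using W(1) \<open>closed K\<close> by (rule open_Diff)
    moreover have "negligible (W - K)"
      using sub by (intro negligible_subset[OF negligible_kinks]) blast
    ultimately show False using x open_not_negligible by blast
  qed
  then show thesis using that by (auto simp: K_def)
qed

text \<open>A nonsingular piece takes the value P c at most once, so P c has finitely many preimages
  in W and c is isolated among them. Near c the nearest preimage is then c itself, and the inverse
  estimate for y = P c reads |x - c| <= k |P x - P c|; this gives \<kappa> = 1 / k.\<close>

lemma linear_growth:
  assumes W: "open W" "\<And>w. w \<in> W \<Longrightarrow> metrically_regular_at P w" and c: "c \<in> W"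
  obtains \<kappa> r where "\<kappa> > 0" "r > 0" "\<And>x. x \<in> ball c r \<Longrightarrow> norm (P x - P c) \<ge> \<kappa> * norm (x - c)"
proof -
  define Z where "Z = {x\<in>W. P x = P c}"
  have "Z \<subseteq> (\<lambda>C. SOME x. affine_map C x = P c) ` \<A>"
  proof
    fix x assume x: "x \<in> Z"
    then obtain C where C: "C \<in> \<A>" "det (fst C) \<noteq> 0" "P x = affine_map C x"
      using nonsingular_piece[OF W] unfolding Z_def by blast
    have inj: "inj ((*v) (fst C))" using C(2) det_nz_iff_inj[of "(*v) (fst C)"] by simp
    have "(SOME x. affine_map C x = P c) = x"
    proof (rule some_equality)
      show "affine_map C x = P c" using C x by (simp add: Z_def)
      fix w assume "affine_map C w = P c"
      then have "fst C *v w = fst C *v x" using \<open>affine_map C x = P c\<close>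
        by (metis add_right_cancel affine_map_def)
      with inj show "w = x" by (simp add: inj_eq)
    qed
    with C(1) show "x \<in> (\<lambda>C. SOME x. affine_map C x = P c) ` \<A>"
      by (intro image_eqI[of _ _ C]) simp_all
  qed
  then have "finite Z" by (rule finite_surj[OF finite_pieces])
  then have "open (W - (Z - {c}))" using W(1) by (intro open_Diff finite_imp_closed) auto
  moreover have "c \<in> W - (Z - {c})" using c by blast
  ultimately obtain s where s: "s > 0" "ball c s \<subseteq> W - (Z - {c})" by (meson openE)
  have iso: "s \<le> dist c z" if "P z = P c" "z \<noteq> c" for z
  proof (rule ccontr)
    assume "\<not> s \<le> dist c z"
    then have "z \<in> ball c s" by simp
    then have "z \<in> W - (Z - {c})" using s by blast
    with that show False by (auto simp: Z_def)
  qed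
  obtain k U V where k: "k > 0" and U: "c \<in> interior U" and V: "P c \<in> interior V"
    and reg: "\<And>x y. x \<in> U \<Longrightarrow> y \<in> V \<Longrightarrow> set_distance x (P -` {y}) \<le> ennreal (k * norm (y - P x))"
    using W(2)[OF c] unfolding metrically_regular_at_def by blast
  obtain d where d: "d > 0" "ball c d \<subseteq> U" using U by (meson mem_interior)
  show thesis
  proof
    \<comment> \<open>Within s / 2 of c, every other preimage of P c is farther from x than c is,
      being at distance at least s from c.\<close>
    show "inverse k > 0" "min d (s / 2) > 0" using k d s by auto
    fix x assume x: "x \<in> ball c (min d (s / 2))"
    have "ennreal (dist x c) \<le> set_distance x (P -` {P c})"
      unfolding set_distance_def
    proof (rule INF_greatest)
      fix z assume "z \<in> P -` {P c}"
      then have "z = c \<or> s \<le> dist c z" using iso by blast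
      moreover have "dist x c < s / 2" using x by (simp add: dist_commute)
      ultimately have "dist x c \<le> dist x z"
        using dist_triangle[of c z x] by (auto simp: dist_commute)
      then show "ennreal (dist x c) \<le> ennreal (dist x z)" by (rule ennreal_leI)
    qed
    also have "\<dots> \<le> ennreal (k * norm (P c - P x))"
      using x d V interior_subset by (intro reg) auto
    finally have "dist x c \<le> k * norm (P c - P x)"
      using k by (simp add: ennreal_le_iff)
    then show "inverse k * norm (x - c) \<le> norm (P x - P c)"
      using k by (simp add: dist_norm norm_minus_commute field_simps)
  qed
qed

end


section \<open>Lipschitz functions and cutoffs\<close>

text \<open>A segment from S to a point outside crosses the frontier, where f vanishes, and the
  Lipschitz bound up to the crossing point is enough. This makes the glued map \<open>Q\<close>
  Lipschitz on the whole space.\<close>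

lemma lipschitz_on_extend_by_zero:
  fixes f :: "'a::euclidean_space \<Rightarrow> 'b::real_normed_vector"
  assumes lip: "K-lipschitz_on S f" and S: "closed S"
    and zero: "\<And>x. x \<in> frontier S \<or> x \<notin> S \<Longrightarrow> f x = 0"
  shows "K-lipschitz_on UNIV f"
proof -
  have K: "K \<ge> 0" using lip by (rule lipschitz_on_nonneg)
  have out: "norm (f x) \<le> K * dist x y" if x: "x \<in> S" and y: "y \<notin> S" for x y
  proof -
    have "closed_segment x y \<inter> frontier S \<noteq> {}"
      using x y by (intro connected_Int_frontier) auto
    then obtain z where z: "z \<in> closed_segment x y" "z \<in> frontier S" by blast
    have "norm (f x) = dist (f x) (f z)" using zero z by (simp add: dist_norm)
    also have "\<dots> \<le> K * dist x z"
      using z(2) S frontier_subset_closed x by (intro lipschitz_onD[OF lip]) auto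
    also have "\<dots> \<le> K * dist x y"
      using dist_in_closed_segment[OF z(1)] K by (intro mult_left_mono) (auto simp: dist_commute)
    finally show ?thesis .
  qed
  show ?thesis
  proof (rule lipschitz_onI[OF _ K])
    fix x y
    consider "x \<in> S" "y \<in> S" | "x \<in> S" "y \<notin> S" | "x \<notin> S" "y \<in> S" | "x \<notin> S" "y \<notin> S" by blast
    then show "dist (f x) (f y) \<le> K * dist x y"
    proof cases
      case 1
      then show ?thesis by (rule lipschitz_onD[OF lip])
    next
      case 2
      then show ?thesis using out[of x y] zero[of y] by (simp add: dist_norm)
    next
      case 3
      then show ?thesis using out[of y x] zero[of x] by (simp add: dist_norm norm_minus_commute)
    next
      case 4
      then show ?thesis using zero K by simp
    qed
  qed
qed

lemma lipschitz_on_scaleR_bounded: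
  fixes f :: "'a::metric_space \<Rightarrow> real" and g :: "'a \<Rightarrow> 'b::real_normed_vector"
  assumes f: "K-lipschitz_on S f" "\<And>x. x \<in> S \<Longrightarrow> \<bar>f x\<bar> \<le> B"
    and g: "M-lipschitz_on S g" "\<And>x. x \<in> S \<Longrightarrow> norm (g x) \<le> D"
    and nonneg: "B \<ge> 0" "D \<ge> 0"
  shows "(B * M + K * D)-lipschitz_on S (\<lambda>x. f x *\<^sub>R g x)"
proof (rule lipschitz_onI)
  have K: "K \<ge> 0" "M \<ge> 0" using f g lipschitz_on_nonneg by blast+
  then show "B * M + K * D \<ge> 0" using nonneg by simp
  fix x y assume xy: "x \<in> S" "y \<in> S"
  have "f x *\<^sub>R g x - f y *\<^sub>R g y = f x *\<^sub>R (g x - g y) + (f x - f y) *\<^sub>R g y"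
    by (simp add: algebra_simps)
  then have "dist (f x *\<^sub>R g x) (f y *\<^sub>R g y) \<le> \<bar>f x\<bar> * dist (g x) (g y) + dist (f x) (f y) * norm (g y)"
    unfolding dist_norm by (metis norm_scaleR norm_triangle_ineq real_norm_def)
  also have "\<dots> \<le> B * (M * dist x y) + (K * dist x y) * D"
    using f(2) g(2) lipschitz_onD[OF f(1) xy] lipschitz_onD[OF g(1) xy] xy K nonneg
    by (intro add_mono mult_mono) auto
  finally show "dist (f x *\<^sub>R g x) (f y *\<^sub>R g y) \<le> (B * M + K * D) * dist x y"
    by (simp add: algebra_simps)
qed

lemma lipschitz_on_bounded:
  fixes f :: "'a::metric_space \<Rightarrow> 'b::real_normed_vector"
  assumes "K-lipschitz_on S f" "bounded S"
  obtains B where "B \<ge> 0" "\<And>x. x \<in> S \<Longrightarrow> norm (f x) \<le> B"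
proof -
  obtain c e where e: "\<And>x. x \<in> S \<Longrightarrow> dist c x \<le> e" using assms(2) by (auto simp: bounded_def)
  show thesis
  proof (cases "S = {}")
    case True
    with that[of 0] show thesis by simp
  next
    case False
    then obtain z where z: "z \<in> S" by blast
    have K: "K \<ge> 0" using assms(1) by (rule lipschitz_on_nonneg)
    have e0: "e \<ge> 0" using e[OF z] zero_le_dist order_trans by blast
    have "norm (f x) \<le> norm (f z) + K * (e + e)" if x: "x \<in> S" for x
    proof -
      have "norm (f x) \<le> norm (f z) + dist (f x) (f z)"
        by (metis add.commute dist_norm norm_triangle_sub)
      also have "dist (f x) (f z) \<le> K * dist x z" using assms(1) x z by (rule lipschitz_onD)
      also have "\<dots> \<le> K * (e + e)"
        using e[OF x] e[OF z] dist_triangle3[of x z c] K by (intro mult_left_mono) auto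
      finally show ?thesis by simp
    qed
    with that[of "norm (f z) + K * (e + e)"] K e0 show thesis by simp
  qed
qed

lemma lipschitz_on_scaleR_ex:
  fixes f :: "'a::metric_space \<Rightarrow> real" and g :: "'a \<Rightarrow> 'b::real_normed_vector"
  assumes "K-lipschitz_on S f" "M-lipschitz_on S g" "bounded S"
  shows "\<exists>K. K-lipschitz_on S (\<lambda>x. f x *\<^sub>R g x)"
proof -
  obtain B where B: "B \<ge> 0" "\<And>x. x \<in> S \<Longrightarrow> norm (f x) \<le> B"
    using lipschitz_on_bounded[OF assms(1,3)] by metis
  obtain D where D: "D \<ge> 0" "\<And>x. x \<in> S \<Longrightarrow> norm (g x) \<le> D"
    using lipschitz_on_bounded[OF assms(2,3)] by metis
  show ?thesis
    using lipschitz_on_scaleR_bounded[OF assms(1) _ assms(2) D(2) B(1) D(1)] B(2) by auto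
qed

lemma lipschitz_on_vec_ex:
  fixes f :: "'a::metric_space \<Rightarrow> real^'n"
  assumes "\<And>i. \<exists>K. K-lipschitz_on S (\<lambda>x. f x $ i)"
  shows "\<exists>K. K-lipschitz_on S f"
proof -
  obtain K where K: "\<And>i. (K i)-lipschitz_on S (\<lambda>x. f x $ i)"
    using choice[of "\<lambda>i K. K-lipschitz_on S (\<lambda>x. f x $ i)"] assms by auto
  have "(\<Sum>i\<in>UNIV. K i)-lipschitz_on S f"
  proof (rule lipschitz_onI)
    show "(\<Sum>i\<in>UNIV. K i) \<ge> 0" using lipschitz_on_nonneg[OF K] by (intro sum_nonneg)
    fix x y assume xy: "x \<in> S" "y \<in> S"
    have "dist (f x) (f y) \<le> (\<Sum>i\<in>UNIV. \<bar>(f x - f y) $ i\<bar>)"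
      unfolding dist_norm by (rule norm_le_l1_cart)
    also have "\<dots> \<le> (\<Sum>i\<in>UNIV. K i * dist x y)"
      using lipschitz_onD[OF K xy] by (intro sum_mono) (simp add: dist_norm)
    finally show "dist (f x) (f y) \<le> (\<Sum>i\<in>UNIV. K i) * dist x y" by (simp add: sum_distrib_right)
  qed
  then show ?thesis by blast
qed

text \<open>Induction on the polynomial; boundedness of S is what keeps products Lipschitz.\<close>

lemma real_polynomial_function_lipschitz_on:
  fixes p :: "'a::euclidean_space \<Rightarrow> real"
  assumes "real_polynomial_function p" and "bounded S"
  shows "\<exists>K. K-lipschitz_on S p"
  using assms(1)
proof induction
  case (linear f)
  obtain K where "K-lipschitz_on S f" by (rule bounded_linear.lipschitz_boundE[OF linear])
  then show ?case by blast
next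
  case (const c)
  show ?case using lipschitz_on_constant by blast
next
  case (add f g)
  then show ?case using lipschitz_on_add by blast
next
  case (mult f g)
  then show ?case using lipschitz_on_scaleR_ex[OF _ _ \<open>bounded S\<close>, of _ f _ g] by auto
qed

lemma polynomial_function_lipschitz_on:
  fixes p :: "'a::euclidean_space \<Rightarrow> real^'n"
  assumes "polynomial_function p" and "bounded S"
  shows "\<exists>K. K-lipschitz_on S p"
proof (rule lipschitz_on_vec_ex)
  fix i
  have "real_polynomial_function (\<lambda>x. p x $ i)"
    using assms(1) bounded_linear_vec_nth[of i] unfolding polynomial_function_def comp_def by blast
  then show "\<exists>K. K-lipschitz_on S (\<lambda>x. p x $ i)"
    using assms(2) by (rule real_polynomial_function_lipschitz_on)
qed

section \<open>A continuously differentiable step function\<close>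

definition hat :: "real \<Rightarrow> real" where
  "hat t = max 0 (1 - \<bar>t\<bar>)"

text \<open>The antiderivative of \<open>hat\<close> that rises from 0 to 1 on [-1, 1], written as
  half the second difference of the truncated square. It shapes both the map \<Psi> and the radial
  cutoff.\<close>

definition ramp :: "real \<Rightarrow> real" where
  "ramp t = ((max 0 (t + 1))\<^sup>2 - 2 * (max 0 t)\<^sup>2 + (max 0 (t - 1))\<^sup>2) / 2"

lemma has_real_derivative_max_0_squared:
  "((\<lambda>t. (max 0 t)\<^sup>2) has_real_derivative 2 * max 0 t) (at (t::real))"
proof -
  consider "t > 0" | "t < 0" | "t = 0" by linarith
  then show ?thesis
  proof cases
    case 1
    then have "((\<lambda>t. t\<^sup>2) has_real_derivative 2 * max 0 t) (at t)"
      by (auto intro!: derivative_eq_intros)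
    then show ?thesis
      by (rule has_field_derivative_transform_within_open[of _ _ _ "{0<..}"]) (use 1 in auto)
  next
    case 2
    then have "((\<lambda>t. 0) has_real_derivative 2 * max 0 t) (at t)"
      by (auto intro!: derivative_eq_intros)
    then show ?thesis
      by (rule has_field_derivative_transform_within_open[of _ _ _ "{..<0}"]) (use 2 in auto)
  next
    case 3
    \<comment> \<open>The slope function of Caratheodory at 0 is max 0 t, since the square of max 0
      t equals max 0 t times t.\<close>
    have "isCont (\<lambda>t. max 0 t) (0::real)" by (intro continuous_intros)
    then show ?thesis
      unfolding CARAT_DERIV using 3 by (intro exI[of _ "\<lambda>t. max 0 t"]) (auto simp: power2_eq_square max_def)
  qed
qed

lemma has_real_derivative_ramp: "(ramp has_real_derivative hat t) (at t)"
proof -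
  have "((\<lambda>s. (max 0 (s + a))\<^sup>2) has_real_derivative 2 * max 0 (t + a)) (at t)" for a
    using DERIV_shift[THEN iffD1, OF has_real_derivative_max_0_squared[of "t + a"]] .
  note this[of 1] this[of 0] this[of "- 1"]
  then have "(ramp has_real_derivative (2 * max 0 (t + 1) - 2 * (2 * max 0 t) + 2 * max 0 (t - 1)) / 2) (at t)"
    unfolding ramp_def[abs_def] by (intro DERIV_cdivide DERIV_add DERIV_diff DERIV_cmult) simp_all
  also have "(2 * max 0 (t + 1) - 2 * (2 * max 0 t) + 2 * max 0 (t - 1)) / 2 = hat t"
    by (auto simp: hat_def max_def abs_if field_simps)
  finally show ?thesis .
qed

lemma lipschitz_on_ramp: "1-lipschitz_on S ramp"
proof -
  have "1-lipschitz_on UNIV ramp"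
  proof (rule bounded_derivative_imp_lipschitz)
    show "(ramp has_derivative (*) (hat t)) (at t within UNIV)" for t
      using has_real_derivative_ramp by (simp add: has_field_derivative_def)
    have "\<bar>hat t\<bar> \<le> 1" for t by (simp add: hat_def)
    then show "onorm ((*) (hat t)) \<le> 1" for t
      by (intro onorm_le) (simp add: abs_mult mult_right_le_one_le mult_left_le_one_le)
  qed auto
  then show ?thesis by (rule lipschitz_on_subset) simp
qed

lemma ramp_eq_0: "t \<le> - 1 \<Longrightarrow> ramp t = 0"
  by (simp add: ramp_def)

lemma ramp_eq_1: "t \<ge> 1 \<Longrightarrow> ramp t = 1"
  by (simp add: ramp_def power2_eq_square algebra_simps)

lemma ramp_bounds: "0 \<le> ramp t" "ramp t \<le> 1"
proof -
  have mono: "ramp s \<le> ramp u" if "s \<le> u" for s u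
  proof (rule DERIV_nonneg_imp_nondecreasing[OF that])
    fix x
    show "\<exists>y. (ramp has_real_derivative y) (at x) \<and> 0 \<le> y"
      by (intro exI[of _ "hat x"] conjI has_real_derivative_ramp) (simp add: hat_def)
  qed
  have "ramp (min t (- 1)) \<le> ramp t" "ramp t \<le> ramp (max t 1)"
    by (intro mono; simp)+
  then show "0 \<le> ramp t" "ramp t \<le> 1" by (simp_all add: ramp_eq_0 ramp_eq_1)
qed

section \<open>A map whose Jacobian determinant is a bump function\<close>

text \<open>This is \<Psi>. Each output coordinate depends on the same input coordinate only, so the
  derivative is diagonal; its determinant, \<open>cube_weight\<close>, is positive inside the cube
  of half-width s around c and zero outside.\<close>

definition cube_ramp :: "real^'n \<Rightarrow> real \<Rightarrow> real^'n \<Rightarrow> real^'n" where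
  "cube_ramp c s y = (\<chi> i. ramp ((y $ i - c $ i) / s))"

lemma lipschitz_on_cube_ramp:
  fixes f :: "'a::metric_space \<Rightarrow> real^'n"
  assumes f: "K-lipschitz_on S f" and s: "s > 0"
  shows "\<exists>M. M-lipschitz_on S (\<lambda>x. cube_ramp c s (f x))"
proof (rule lipschitz_on_vec_ex)
  fix i
  have "K-lipschitz_on S (\<lambda>x. f x $ i)"
  proof (rule lipschitz_onI)
    fix x y assume "x \<in> S" "y \<in> S"
    have "dist (f x $ i) (f y $ i) \<le> dist (f x) (f y)" by (rule dist_vec_nth_le)
    also have "\<dots> \<le> K * dist x y" by (rule lipschitz_onD[OF f]) fact+
    finally show "dist (f x $ i) (f y $ i) \<le> K * dist x y" .
  qed (rule lipschitz_on_nonneg[OF f])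
  then have "(\<bar>1 / s\<bar> * (K + 0))-lipschitz_on S (\<lambda>x. 1 / s * (f x $ i - c $ i))"
    by (intro lipschitz_intros)
  from lipschitz_on_compose2[OF this lipschitz_on_ramp]
  show "\<exists>M. M-lipschitz_on S (\<lambda>x. cube_ramp c s (f x) $ i)"
    by (auto simp: cube_ramp_def)
qed

definition cube_weight :: "real^'n \<Rightarrow> real \<Rightarrow> real^'n \<Rightarrow> real" where
  "cube_weight c s y = (\<Prod>i\<in>UNIV. hat ((y $ i - c $ i) / s) / s)"

text \<open>The chain rule for \<open>cube_ramp c s\<close> after a map with derivative A and value
  y: the diagonal factor scales the rows of A.\<close>

definition cube_ramp_matrix :: "real^'n \<Rightarrow> real \<Rightarrow> real^'n \<Rightarrow> real^'n^'n \<Rightarrow> real^'n^'n" where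
  "cube_ramp_matrix c s y A = (\<chi> i. (hat ((y $ i - c $ i) / s) / s) *s A $ i)"

lemma det_cube_ramp_matrix: "det (cube_ramp_matrix c s y A) = cube_weight c s y * det A"
  unfolding cube_ramp_matrix_def cube_weight_def by (subst det_rows_mul) simp

lemma has_derivative_cube_ramp:
  fixes f :: "real^'n \<Rightarrow> real^'n"
  assumes f: "(f has_derivative (*v) A) (at x)" and s: "s > 0"
  shows "((\<lambda>x. cube_ramp c s (f x)) has_derivative (*v) (cube_ramp_matrix c s (f x) A)) (at x)"
proof (rule has_derivative_componentwise_within[THEN iffD2], rule ballI)
  fix b :: "real^'n" assume "b \<in> Basis"
  then obtain i where b: "b = axis i 1" by (auto simp: Basis_vec_def)
  have "((\<lambda>x. f x $ i) has_derivative (\<lambda>v. (A *v v) $ i)) (at x)"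
    using bounded_linear.has_derivative[OF bounded_linear_vec_nth f] .
  then have "((\<lambda>x. (f x $ i - c $ i) / s) has_derivative (\<lambda>v. ((A *v v) $ i) / s)) (at x)"
    using s by (auto intro!: derivative_eq_intros)
  from has_derivative_compose[OF this has_real_derivative_ramp[unfolded has_field_derivative_def]]
  show "((\<lambda>x. cube_ramp c s (f x) \<bullet> b) has_derivative (\<lambda>v. (cube_ramp_matrix c s (f x) A *v v) \<bullet> b)) (at x)"
    by (simp add: b inner_axis cube_ramp_def cube_ramp_matrix_def matrix_vector_mul_component
        scalar_mult_eq_scaleR)
qed

lemma cube_weight_nonneg: "s > 0 \<Longrightarrow> cube_weight c s y \<ge> 0"
  unfolding cube_weight_def hat_def by (intro prod_nonneg) auto

lemma cube_weight_center: "s > 0 \<Longrightarrow> cube_weight c s c > 0"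
  unfolding cube_weight_def hat_def by (intro prod_pos) auto

text \<open>A nonzero weight bounds every coordinate of y - c by s in absolute value, so the sum of
  these values, and with it the norm, is below CARD('n) times s.\<close>

lemma cube_weight_eq_0:
  fixes y :: "real^'n" and s :: real
  assumes "s > 0" "norm (y - c) \<ge> CARD('n) * s"
  shows "cube_weight c s y = 0"
proof (rule ccontr)
  assume "cube_weight c s y \<noteq> 0"
  then have "hat ((y $ i - c $ i) / s) \<noteq> 0" for i
    by (auto simp: cube_weight_def)
  then have "\<bar>(y $ i - c $ i) / s\<bar> < 1" for i
    unfolding hat_def by (metis diff_gt_0_iff_gt max.absorb1 not_less)
  then have "\<bar>(y - c) $ i\<bar> < s" for i
    using assms(1) by (simp add: abs_divide divide_less_eq)
  then have "(\<Sum>i\<in>UNIV. \<bar>(y - c) $ i\<bar>) < (\<Sum>i\<in>(UNIV::'n set). s)"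
    by (intro sum_strict_mono) auto
  with norm_le_l1_cart[of "y - c"] assms(2) show False by simp
qed

lemma continuous_on_cube_weight:
  "continuous_on S f \<Longrightarrow> continuous_on S (\<lambda>x. cube_weight c s (f x))"
  unfolding cube_weight_def hat_def divide_inverse by (intro continuous_intros)


section \<open>The degree argument\<close>

text \<open>If \<open>Q\<close> avoided a cube around \<open>y\<close>, then composing with \<open>cube_ramp\<close> would turn
  \<open>det DP\<close> and \<open>det DQ\<close> into two functions with equal integrals, of which the second vanishes
  and the first has constant sign and is nonzero near the solutions of \<open>P x = y\<close>.\<close>

lemma perturbation_hits_value:
  fixes P Q :: "real^'n::{finite,wellorder} \<Rightarrow> real^'n::_"
  assumes pa: "piecewise_affine P \<A> \<H> L"
    and reg: "\<And>w. w \<in> ball c r \<Longrightarrow> metrically_regular_at P w"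
    and \<rho>: "\<rho> < r" and y: "y \<in> P ` ball c \<rho>"
    and lipQ: "K-lipschitz_on UNIV Q"
    and diffQ: "\<And>x. x \<notin> piecewise_affine.kinks \<H> \<Longrightarrow> Q differentiable at x"
    and PQ: "\<And>x. x \<notin> cball c \<rho> \<Longrightarrow> Q x = P x"
    and \<eta>: "\<eta> > 0"
  shows "\<exists>x\<in>cball c \<rho>. norm (Q x - y) < \<eta>"
proof (rule ccontr)
  assume "\<not> ?thesis"
  then have far: "norm (Q x - y) \<ge> \<eta>" if "x \<in> cball c \<rho>" for x
    using that by (meson not_less)
  interpret piecewise_affine P \<A> \<H> L by (rule pa)
  \<comment> \<open>The cube of half-width s around y lies in the ball of radius \<eta>, which
    \<open>Q\<close> avoids on the closed ball; hence the weight vanishes along \<open>Q\<close>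
    there.\<close>
  define s where "s = \<eta> / CARD('n)"
  have s: "s > 0" "CARD('n) * s = \<eta>" using \<eta> by (simp_all add: s_def)
  define J where "J x = matrix (frechet_derivative Q (at x))" for x
  have derQ: "(Q has_derivative (*v) (J x)) (at x)" if "x \<notin> kinks" for x
  proof -
    have der: "(Q has_derivative frechet_derivative Q (at x)) (at x)"
      using diffQ[OF that] frechet_derivative_works by blast
    then have "(*v) (J x) = frechet_derivative Q (at x)"
      unfolding J_def by (metis has_derivative_bounded_linear matrix_vector_mul(3))
    with der show ?thesis by simp
  qed
  define h k where "h x = cube_ramp y s (P x)" and "k x = cube_ramp y s (Q x)" for x
  define h' k' where "h' x = cube_ramp_matrix y s (P x) (jacobian x)"
    and "k' x = cube_ramp_matrix y s (Q x) (J x)" for x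
  obtain M\<^sub>1 where M1: "M\<^sub>1-lipschitz_on UNIV h"
    unfolding h_def using lipschitz_on_cube_ramp[OF lipschitz s(1)] by blast
  obtain M\<^sub>2 where M2: "M\<^sub>2-lipschitz_on UNIV k"
    unfolding k_def using lipschitz_on_cube_ramp[OF lipQ s(1)] by blast
  have "\<exists>I. ((\<lambda>x. det (h' x)) has_integral I) (cball c \<rho> - kinks) \<and>
      ((\<lambda>x. det (k' x)) has_integral I) (cball c \<rho> - kinks)"
  proof (rule has_integral_det_derivative_cong)
    show "(max M\<^sub>1 M\<^sub>2)-lipschitz_on UNIV h" "(max M\<^sub>1 M\<^sub>2)-lipschitz_on UNIV k"
      by (rule lipschitz_on_mono[OF M1] lipschitz_on_mono[OF M2]; simp)+
    show "(h has_derivative (*v) (h' x)) (at x)" if "x \<in> cball c \<rho> - kinks" for x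
      unfolding h_def h'_def using that by (intro has_derivative_cube_ramp has_derivative_jacobian s) blast
    show "(k has_derivative (*v) (k' x)) (at x)" if "x \<in> cball c \<rho> - kinks" for x
      unfolding k_def k'_def using that by (intro has_derivative_cube_ramp derQ s) blast
    show "h x = k x" if "x \<notin> cball c \<rho>" for x
      using PQ[OF that] by (simp add: h_def k_def)
  qed (simp_all add: negligible_kinks)
  then obtain I where I: "((\<lambda>x. det (h' x)) has_integral I) (cball c \<rho> - kinks)"
      "((\<lambda>x. det (k' x)) has_integral I) (cball c \<rho> - kinks)" by blast
  have "((\<lambda>x. det (k' x)) has_integral 0) (cball c \<rho> - kinks)"
  proof (rule has_integral_is_0)
    fix x assume "x \<in> cball c \<rho> - kinks"
    then have "cube_weight y s (Q x) = 0"
      using far[of x] s by (intro cube_weight_eq_0) auto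
    then show "det (k' x) = 0" by (simp add: k'_def det_cube_ramp_matrix)
  qed
  with I have int0: "((\<lambda>x. det (h' x)) has_integral 0) (cball c \<rho> - kinks)"
    by (metis has_integral_unique)
  obtain x\<^sub>0 where x0: "x\<^sub>0 \<in> ball c \<rho>" "P x\<^sub>0 = y" using y by blast
  \<comment> \<open>The solution \<open>x\<^sub>0\<close> may be a kink, but the weight stays
    positive near it, and there are points off \<open>kinks\<close> nearby.\<close>
  define O1 where "O1 = ball c \<rho> \<inter> {x. cube_weight y s (P x) > 0}"
  have "open O1"
    unfolding O1_def
    by (intro open_Int open_ball open_Collect_less continuous_on_const continuous_on_cube_weight continuous)
  moreover have "x\<^sub>0 \<in> O1" using x0 s cube_weight_center by (simp add: O1_def)
  ultimately have "\<not> O1 \<subseteq> kinks"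
    using negligible_kinks by (metis empty_iff negligible_subset open_not_negligible)
  then obtain x\<^sub>1 where x1: "x\<^sub>1 \<in> O1" "x\<^sub>1 \<notin> kinks" by blast
  obtain C e where e: "e > 0" "ball x\<^sub>1 e \<inter> kinks = {}"
      and C: "\<And>w. w \<in> ball x\<^sub>1 e \<Longrightarrow> P w = affine_map C w"
    using local_piece[OF x1(2)] by metis
  have JC: "jacobian w = fst C" if "w \<in> ball x\<^sub>1 e" for w
    by (rule affine_piece_derivative(2)[OF open_ball that C])
  have "open (O1 \<inter> ball x\<^sub>1 e)" "x\<^sub>1 \<in> O1 \<inter> ball x\<^sub>1 e"
    using \<open>open O1\<close> x1 e by auto
  then obtain a b where ab: "cbox a b \<subseteq> O1 \<inter> ball x\<^sub>1 e" "x\<^sub>1 \<in> box a b"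
    by (meson open_contains_cbox)
  have sub: "cbox a b \<subseteq> cball c \<rho> - kinks"
    using ab(1) e(2) unfolding O1_def by force
  \<comment> \<open>The constant factor makes the integrand nonnegative, whichever common sign the
    Jacobian determinants of \<open>P\<close> have.\<close>
  define f where "f x = det (jacobian x\<^sub>1) * det (h' x)" for x
  have f_int: "(f has_integral 0) (cball c \<rho> - kinks)"
    unfolding f_def using has_integral_mult_right[OF int0, of "det (jacobian x\<^sub>1)"] by simp
  have x1r: "x\<^sub>1 \<in> ball c r - kinks" using x1 \<rho> by (auto simp: O1_def)
  have f_eq: "f x = cube_weight y s (P x) * (det (jacobian x\<^sub>1) * det (jacobian x))" for x
    by (simp add: f_def h'_def det_cube_ramp_matrix)
  have f_nonneg: "f x \<ge> 0" if "x \<in> cball c \<rho> - kinks" for x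
  proof -
    have "x \<in> ball c r - kinks" using that \<rho> by auto
    from coherent_orientation[OF reg x1r this] cube_weight_nonneg[OF s(1), of y "P x"]
    show ?thesis by (simp add: f_eq)
  qed
  have f_cont: "continuous_on (cbox a b) f"
  proof -
    have "continuous_on (cbox a b) (\<lambda>x. cube_weight y s (P x) * (det (jacobian x\<^sub>1) * det (fst C)))"
      by (intro continuous_on_mult continuous_on_cube_weight continuous continuous_on_const)
    moreover have "cube_weight y s (P x) * (det (jacobian x\<^sub>1) * det (fst C)) = f x" if "x \<in> cbox a b" for x
    proof -
      have "x \<in> ball x\<^sub>1 e" using ab(1) that by blast
      from JC[OF this] show ?thesis by (simp add: f_eq)
    qed
    ultimately show ?thesis by (rule continuous_on_eq)
  qed
  obtain j where j: "(f has_integral j) (cbox a b)"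
    using integrable_continuous[OF f_cont] by blast
  \<comment> \<open>By nonnegativity the integral over the small box lies between 0 and the total
    integral, which is 0.\<close>
  have "j \<le> 0" using has_integral_subset_le[OF sub j f_int] f_nonneg by blast
  moreover have "j \<ge> 0" using has_integral_nonneg[OF j] f_nonneg sub by blast
  ultimately have "(f has_integral 0) (cbox a b)" using j by simp
  then have "f x\<^sub>1 = 0"
    using has_integral_0_cbox_imp_0[OF f_cont _ _ _ , of x\<^sub>1] f_nonneg sub ab(2) box_subset_cbox by blast
  moreover have "f x\<^sub>1 > 0"
    using coherent_orientation[OF reg x1r x1r] x1 by (simp add: f_eq O1_def)
  ultimately show False by simp
qed

lemma radial_cutoff:
  fixes c :: "real^'n"
  assumes "\<rho> > 0"
  obtains \<phi> :: "real^'n \<Rightarrow> real" where "\<And>x. \<phi> differentiable at x" "\<And>x. 0 \<le> \<phi> x" "\<And>x. \<phi> x \<le> 1"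
    "\<And>x. x \<in> cball c (\<rho> / 2) \<Longrightarrow> \<phi> x = 1" "\<And>x. x \<notin> ball c \<rho> \<Longrightarrow> \<phi> x = 0"
    "\<exists>K. K-lipschitz_on (cball c \<rho>) \<phi>"
proof
  \<comment> \<open>An affine function of the squared distance, hence differentiable at c as well.
    The coefficients give the value -1 at distance \<rho> / 2 and 1 at distance \<rho>, where
    \<open>ramp\<close> has reached its end values 0 and 1.\<close>
  define q where "q x = 8 / (3 * \<rho>\<^sup>2) * ((x - c) \<bullet> (x - c)) - 5 / 3" for x
  have q: "q x = 8 / 3 * (dist c x / \<rho>)\<^sup>2 - 5 / 3" for x
    by (simp add: q_def power2_norm_eq_inner[symmetric] dist_norm norm_minus_commute power_divide)
  let ?\<phi> = "\<lambda>x. 1 - ramp (q x)"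
  have ramp_diff: "ramp differentiable at t" for t
    using has_real_derivative_ramp real_differentiable_def by blast
  have "q differentiable at x" for x
    unfolding q_def[abs_def] by (intro differentiable_diff differentiable_mult differentiable_const differentiable_inner differentiable_ident)
  then show "?\<phi> differentiable at x" for x
    using differentiable_chain_at[OF _ ramp_diff, of q x]
    by (intro differentiable_diff differentiable_const) (simp add: comp_def)
  show "0 \<le> ?\<phi> x" "?\<phi> x \<le> 1" for x
    using ramp_bounds[of "q x"] by auto
  show "?\<phi> x = 1" if "x \<in> cball c (\<rho> / 2)" for x
  proof -
    have "(dist c x / \<rho>)\<^sup>2 \<le> (1 / 2)\<^sup>2"
      using that assms by (intro power_mono) (auto simp: field_simps)
    then show ?thesis by (subst ramp_eq_0) (simp_all add: q power2_eq_square)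
  qed
  show "?\<phi> x = 0" if "x \<notin> ball c \<rho>" for x
  proof -
    have "1\<^sup>2 \<le> (dist c x / \<rho>)\<^sup>2"
      using that assms by (intro power_mono) auto
    then show ?thesis by (subst ramp_eq_1) (simp_all add: q)
  qed
  have "1-lipschitz_on (cball c \<rho>) (\<lambda>x. norm (x - c))"
    by (rule lipschitz_onI) (auto simp: dist_norm intro: order_trans[OF norm_triangle_ineq3])
  from lipschitz_on_scaleR_ex[OF this this bounded_cball]
  obtain K where K: "K-lipschitz_on (cball c \<rho>) (\<lambda>x. (x - c) \<bullet> (x - c))"
    by (auto simp: power2_norm_eq_inner[symmetric] power2_eq_square)
  have "(\<bar>8 / (3 * \<rho>\<^sup>2)\<bar> * K + 0)-lipschitz_on (cball c \<rho>) q"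
    unfolding q_def[abs_def] by (intro lipschitz_on_diff lipschitz_on_cmult_real K lipschitz_on_constant)
  from lipschitz_on_compose2[OF this lipschitz_on_ramp]
  have "(0 + 1 * (\<bar>8 / (3 * \<rho>\<^sup>2)\<bar> * K + 0))-lipschitz_on (cball c \<rho>) ?\<phi>"
    by (intro lipschitz_on_diff lipschitz_on_constant)
  then show "\<exists>K. K-lipschitz_on (cball c \<rho>) ?\<phi>" by blast
qed

lemma open_in_point_perturbed_wellorder:
  fixes P F :: "real^'n::{finite,wellorder} \<Rightarrow> real^'n::_"
  assumes pa: "piecewise_affine P \<A> \<H> L"
    and W: "open W" "c \<in> W" "\<And>w. w \<in> W \<Longrightarrow> metrically_regular_at P w"
    and F: "open U" "c \<in> U" "continuous_on U F" "F c = P c"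
    and approx: "\<And>\<epsilon>. \<epsilon> > 0 \<Longrightarrow> \<exists>d>0. \<forall>x\<in>ball c d. norm (F x - P x) \<le> \<epsilon> * norm (x - c)"
  shows "open_in_point F c"
  unfolding open_in_point_def
proof (intro allI impI)
  interpret piecewise_affine P \<A> \<H> L by (rule pa)
  fix N assume N: "c \<in> interior N"
  obtain \<kappa> r where \<kappa>: "\<kappa> > 0" "r > 0" "\<And>x. x \<in> ball c r \<Longrightarrow> norm (P x - P c) \<ge> \<kappa> * norm (x - c)"
    using linear_growth[OF W(1,3,2)] by metis
  \<comment> \<open>A quarter of the growth rate: on the outer half of the ball this error, the
    polynomial approximation and the offset of y together must stay below \<kappa> |x - c|.\<close>
  obtain d where d: "d > 0" "\<And>x. x \<in> ball c d \<Longrightarrow> norm (F x - P x) \<le> \<kappa> / 4 * norm (x - c)"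
    using approx[of "\<kappa> / 4"] \<kappa>(1) by auto
  have "open (interior N \<inter> U \<inter> W \<inter> ball c r \<inter> ball c d)"
    by (intro open_Int open_interior open_ball F W)
  moreover have "c \<in> interior N \<inter> U \<inter> W \<inter> ball c r \<inter> ball c d"
    using N W F \<kappa> d by simp
  ultimately obtain R where R: "R > 0" "ball c R \<subseteq> interior N \<inter> U \<inter> W \<inter> ball c r \<inter> ball c d"
    by (meson openE)
  \<comment> \<open>Half of R, so that the closed ball lies inside an open ball of regular points,
    as \<open>perturbation_hits_value\<close> requires.\<close>
  define \<rho> where "\<rho> = R / 2"
  have \<rho>: "\<rho> > 0" "\<rho> < R" "cball c \<rho> \<subseteq> ball c R" using R by (auto simp: \<rho>_def)
  obtain \<delta> where \<delta>: "\<delta> > 0" "ball (P c) \<delta> \<subseteq> P ` ball c \<rho>"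
    using metrically_regular_at_imp_open_in_point[OF W(3)[OF W(2)] \<rho>(1)] by blast
  have contF: "continuous_on (cball c \<rho>) F"
    using F(3) R \<rho> by (meson continuous_on_subset le_inf_iff order_trans)
  have "ball (F c) (min \<delta> (\<kappa> * \<rho> / 8)) \<subseteq> F ` cball c \<rho>"
  proof
    fix y assume y: "y \<in> ball (F c) (min \<delta> (\<kappa> * \<rho> / 8))"
    show "y \<in> F ` cball c \<rho>"
    proof (rule ccontr)
      assume "y \<notin> F ` cball c \<rho>"
      moreover have "closed (F ` cball c \<rho>)"
        using contF compact_cball compact_continuous_image compact_imp_closed by blast
      ultimately obtain s where s: "s > 0" "\<And>x. x \<in> cball c \<rho> \<Longrightarrow> s \<le> dist y (F x)"
        using separate_point_closed[of "F ` cball c \<rho>" y] by blast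
      \<comment> \<open>The bound s / 2 serves the inner half of the ball, where |y - F x| < 2
        \<eta> <= s would follow; \<kappa> \<rho> / 8 serves the outer half.\<close>
      define \<eta> where "\<eta> = min (s / 2) (\<kappa> * \<rho> / 8)"
      have \<eta>: "\<eta> > 0" using s \<kappa> \<rho> by (simp add: \<eta>_def)
      \<comment> \<open>\<open>F\<close> is merely continuous here, whereas a polynomial can be
        glued to \<open>P\<close> with a result that is Lipschitz and differentiable off
        \<open>kinks\<close>.\<close>
      obtain G where G: "polynomial_function G" "\<And>x. x \<in> cball c \<rho> \<Longrightarrow> norm (F x - G x) < \<eta>"
        using Stone_Weierstrass_polynomial_function[OF compact_cball contF \<eta>] by blast
      obtain \<phi> where \<phi>: "\<And>x. \<phi> differentiable at x" "\<And>x. (0::real) \<le> \<phi> x" "\<And>x. \<phi> x \<le> 1"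
        "\<And>x. x \<in> cball c (\<rho> / 2) \<Longrightarrow> \<phi> x = 1" "\<And>x. x \<notin> ball c \<rho> \<Longrightarrow> \<phi> x = 0"
        "\<exists>K. K-lipschitz_on (cball c \<rho>) \<phi>"
        by (rule radial_cutoff[OF \<rho>(1), of c]) (rule that, assumption+)
      define Q where "Q x = P x + \<phi> x *\<^sub>R (G x - P x)" for x
      have "\<exists>K. K-lipschitz_on UNIV Q"
      proof -
        obtain K\<^sub>1 where K1: "K\<^sub>1-lipschitz_on (cball c \<rho>) \<phi>" using \<phi>(6) by blast
        obtain K\<^sub>2 where K2: "K\<^sub>2-lipschitz_on (cball c \<rho>) G"
          using polynomial_function_lipschitz_on[OF G(1) bounded_cball] by blast
        have "L-lipschitz_on (cball c \<rho>) P" by (rule lipschitz_on_subset[OF lipschitz]) simp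
        from lipschitz_on_scaleR_ex[OF K1 lipschitz_on_diff[OF K2 this] bounded_cball]
        obtain K where "K-lipschitz_on (cball c \<rho>) (\<lambda>x. \<phi> x *\<^sub>R (G x - P x))" by blast
        then have "K-lipschitz_on UNIV (\<lambda>x. \<phi> x *\<^sub>R (G x - P x))"
          by (rule lipschitz_on_extend_by_zero) (use \<rho>(1) \<phi>(5) in auto)
        from lipschitz_on_add[OF lipschitz this] show ?thesis
          unfolding Q_def[abs_def] by blast
      qed
      then obtain K where lipQ: "K-lipschitz_on UNIV Q" by blast
      have "\<exists>x\<in>cball c \<rho>. norm (Q x - y) < \<eta>"
      proof (rule perturbation_hits_value[OF pa _ \<rho>(2) _ lipQ _ _ \<eta>])
        show "metrically_regular_at P w" if "w \<in> ball c R" for w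
          using that R(2) W(3) by blast
        show "y \<in> P ` ball c \<rho>" using y \<delta>(2) F(4) by (intro subsetD[OF \<delta>(2)]) simp
        show "Q x = P x" if "x \<notin> cball c \<rho>" for x
          using \<phi>(5)[of x] that by (simp add: Q_def)
        show "Q differentiable at x" if "x \<notin> kinks" for x
        proof -
          have "P differentiable at x" using has_derivative_jacobian[OF that] by (rule differentiableI)
          moreover have "G differentiable at x" by (rule differentiable_at_polynomial_function[OF G(1)])
          ultimately show ?thesis
            unfolding Q_def[abs_def]
            by (intro differentiable_add differentiable_scaleR differentiable_diff \<phi>(1))
        qed
      qed
      then obtain x where x: "x \<in> cball c \<rho>" "norm (Q x - y) < \<eta>" by blast
      show False
      proof (cases "x \<in> cball c (\<rho> / 2)")
        case True
        then have "Q x = G x" using \<phi>(4) by (simp add: Q_def)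
        then have "dist y (F x) < \<eta> + \<eta>"
          using x G(2)[OF x(1)] dist_triangle[of y "F x" "G x"]
          by (simp add: dist_norm norm_minus_commute)
        with s(2)[OF x(1)] show False by (simp add: \<eta>_def)
      next
        case False
        define t where "t = norm (x - c)"
        have t: "t > \<rho> / 2" using False by (simp add: t_def dist_norm norm_minus_commute)
        have xR: "x \<in> ball c r" "x \<in> ball c d" using x(1) \<rho>(3) R(2) by blast+
        have grow: "norm (P x - P c) \<ge> \<kappa> * t" using \<kappa>(3)[OF xR(1)] by (simp add: t_def)
        have "norm (\<phi> x *\<^sub>R (G x - P x)) \<le> norm (G x - P x)"
          using \<phi>(2,3)[of x] by (simp add: mult_left_le_one_le)
        also have "\<dots> \<le> norm (F x - G x) + norm (F x - P x)"
          using norm_triangle_ineq4[of "F x - P x" "F x - G x"] by simp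
        also have "\<dots> \<le> \<eta> + \<kappa> / 4 * t"
          using G(2)[OF x(1)] d(2)[OF xR(2)] by (simp add: t_def)
        finally have pert: "norm (\<phi> x *\<^sub>R (G x - P x)) \<le> \<eta> + \<kappa> / 4 * t" .
        have yc: "norm (y - P c) < \<kappa> * \<rho> / 8"
          using y F(4) by (simp add: dist_norm norm_minus_commute)
        have "norm (P x - P c) \<le> norm (Q x - y) + norm (y - P c) + norm (\<phi> x *\<^sub>R (G x - P x))"
        proof -
          have "norm (P x - P c) = norm ((Q x - y) + (y - P c) - \<phi> x *\<^sub>R (G x - P x))"
            by (simp add: Q_def)
          then show ?thesis
            using norm_triangle_ineq4[of "(Q x - y) + (y - P c)" "\<phi> x *\<^sub>R (G x - P x)"]
              norm_triangle_ineq[of "Q x - y" "y - P c"] by linarith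
        qed
        moreover have "\<eta> \<le> \<kappa> * \<rho> / 8" by (simp add: \<eta>_def)
        moreover have "\<kappa> / 4 * t = \<kappa> * t / 4" by simp
        \<comment> \<open>In total \<kappa> t < \<eta> + \<kappa> \<rho> / 8 + \<eta> + \<kappa> t /
          4 <= 3 \<kappa> \<rho> / 8 + \<kappa> t / 4, hence t < \<rho> / 2.\<close>
        ultimately have "\<kappa> * t < \<kappa> * \<rho> / 2"
          using grow x(2) yc pert by linarith
        then have "\<kappa> * t < \<kappa> * (\<rho> / 2)" by simp
        with \<kappa>(1) t show False by simp
      qed
    qed
  qed
  also have "F ` cball c \<rho> \<subseteq> F ` N"
    using \<rho>(3) R(2) interior_subset by blast
  finally show "F c \<in> interior (F ` N)"
    using \<delta>(1) \<kappa>(1) \<rho>(1) by (intro interiorI[OF open_ball]) auto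
qed

section \<open>Continuous selections of affine functions\<close>

text \<open>A finite set of candidate pieces instead of a partition into polyhedra: this form passes
  through linear combinations and absolute values by enumerating the new candidates.\<close>

definition piecewise_affine_function :: "(real^'n \<Rightarrow> real) \<Rightarrow> bool" where
  "piecewise_affine_function f \<longleftrightarrow> (\<exists>L. L-lipschitz_on UNIV f) \<and>
     (\<exists>S. finite S \<and> (\<forall>x. \<exists>(a, b)\<in>S. f x = a \<bullet> x + b))"

lemma piecewise_affine_function_affine:
  "piecewise_affine_function (\<lambda>x. a \<bullet> x + b)"
proof -
  have "\<exists>L. L-lipschitz_on UNIV (\<lambda>x. a \<bullet> x + b)"
    using bounded_linear.lipschitz_boundE[OF bounded_linear_inner_right[of a]]
      lipschitz_on_add[OF _ lipschitz_on_constant] by metis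
  moreover have "\<exists>S. finite S \<and> (\<forall>x. \<exists>(a', b')\<in>S. a \<bullet> x + b = a' \<bullet> x + b')"
    by (intro exI[of _ "{(a, b)}"]) simp
  ultimately show ?thesis unfolding piecewise_affine_function_def by blast
qed

lemma piecewise_affine_function_combination:
  assumes "piecewise_affine_function f" "piecewise_affine_function g"
  shows "piecewise_affine_function (\<lambda>x. r * f x + s * g x + t)"
proof -
  obtain L S M T where f: "L-lipschitz_on UNIV f" "finite S" "\<And>x. \<exists>(a, b)\<in>S. f x = a \<bullet> x + b"
    and g: "M-lipschitz_on UNIV g" "finite T" "\<And>x. \<exists>(a, b)\<in>T. g x = a \<bullet> x + b"
    using assms unfolding piecewise_affine_function_def by metis
  have "(\<bar>r\<bar> * L + \<bar>s\<bar> * M + 0)-lipschitz_on UNIV (\<lambda>x. r * f x + s * g x + t)"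
    by (intro lipschitz_on_add lipschitz_on_cmult_real lipschitz_on_constant f g)
  moreover have "\<exists>(a, b)\<in>(\<lambda>((a, b), (a', b')). (r *\<^sub>R a + s *\<^sub>R a', r * b + s * b' + t)) ` (S \<times> T).
      r * f x + s * g x + t = a \<bullet> x + b" for x
  proof -
    obtain a b a' b' where "(a, b) \<in> S" "f x = a \<bullet> x + b" "(a', b') \<in> T" "g x = a' \<bullet> x + b'"
      using f(3)[of x] g(3)[of x] by blast
    then show ?thesis
      by (intro bexI[of _ "(r *\<^sub>R a + s *\<^sub>R a', r * b + s * b' + t)"] image_eqI[of _ _ "((a, b), (a', b'))"])
        (simp_all add: inner_add_left algebra_simps)
  qed
  moreover have "finite ((\<lambda>((a, b), (a', b')). (r *\<^sub>R a + s *\<^sub>R a', r * b + s * b' + t)) ` (S \<times> T))"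
    using f(2) g(2) by simp
  ultimately show ?thesis unfolding piecewise_affine_function_def by blast
qed

lemma piecewise_affine_function_abs:
  assumes "piecewise_affine_function f"
  shows "piecewise_affine_function (\<lambda>x. \<bar>f x\<bar>)"
proof -
  obtain L S where f: "L-lipschitz_on UNIV f" "finite S" "\<And>x. \<exists>(a, b)\<in>S. f x = a \<bullet> x + b"
    using assms unfolding piecewise_affine_function_def by metis
  have "L-lipschitz_on UNIV (\<lambda>x. \<bar>f x\<bar>)"
  proof (rule lipschitz_onI)
    fix x y
    have "dist \<bar>f x\<bar> \<bar>f y\<bar> \<le> dist (f x) (f y)" by (simp add: dist_real_def)
    also have "\<dots> \<le> L * dist x y" using lipschitz_onD[OF f(1)] by simp
    finally show "dist \<bar>f x\<bar> \<bar>f y\<bar> \<le> L * dist x y" .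
  qed (rule lipschitz_on_nonneg[OF f(1)])
  moreover have "\<exists>(a, b)\<in>S \<union> (\<lambda>(a, b). (- a, - b)) ` S. \<bar>f x\<bar> = a \<bullet> x + b" for x
  proof -
    obtain a b where ab: "(a, b) \<in> S" "f x = a \<bullet> x + b" using f(3)[of x] by blast
    show ?thesis
    proof (cases "f x \<ge> 0")
      case True
      with ab show ?thesis by (intro bexI[of _ "(a, b)"]) simp_all
    next
      case False
      with ab show ?thesis
        by (intro bexI[of _ "(- a, - b)"] UnI2 image_eqI[of _ _ "(a, b)"]) simp_all
    qed
  qed
  moreover have "finite (S \<union> (\<lambda>(a, b). (- a, - b)) ` S)" using f(2) by simp
  ultimately show ?thesis unfolding piecewise_affine_function_def by blast
qed

lemma piecewise_affine_function_bigo: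
  fixes f :: "real^'n \<Rightarrow> real"
  assumes "piecewise_affine_function f" "f c = 0"
  shows "f \<in> O[at c](\<lambda>x. norm (x - c))"
proof -
  obtain L where L: "L-lipschitz_on UNIV f"
    using assms(1) unfolding piecewise_affine_function_def by blast
  show ?thesis
    using lipschitz_on_normD[OF L, of _ c] assms(2) by (intro bigoI[of _ L]) simp
qed

text \<open>A candidate is chosen for each component independently; \<open>\<A>\<close> holds all
  combinations, including those that are never active.\<close>

lemma piecewise_affine_vector:
  fixes P :: "real^'n \<Rightarrow> real^'n"
  assumes "\<And>i. piecewise_affine_function (\<lambda>x. P x $ i)"
  obtains \<A> L where "finite \<A>" "\<And>x. \<exists>C\<in>\<A>. P x = affine_map C x" "L-lipschitz_on UNIV P"
proof -
  have "\<exists>S. \<forall>i. finite (S i) \<and> (\<forall>x. \<exists>(a, b)\<in>S i. P x $ i = a \<bullet> x + b)"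
    using assms unfolding piecewise_affine_function_def by (intro choice) blast
  then obtain S where S: "\<And>i. finite (S i)" "\<And>i x. \<exists>(a, b)\<in>S i. P x $ i = a \<bullet> x + b"
    by blast
  define \<A> where "\<A> = (\<lambda>s. (\<chi> i. fst (s i), \<chi> i. snd (s i))) ` (PiE UNIV S)"
  have "finite \<A>"
    unfolding \<A>_def by (intro finite_imageI finite_PiE S) simp
  moreover have "\<exists>C\<in>\<A>. P x = affine_map C x" for x
  proof -
    have "\<exists>s. \<forall>i. s i \<in> S i \<and> P x $ i = fst (s i) \<bullet> x + snd (s i)"
    proof (intro choice allI)
      fix i
      obtain a b where "(a, b) \<in> S i" "P x $ i = a \<bullet> x + b" using S(2)[of i x] by blast
      then show "\<exists>p. p \<in> S i \<and> P x $ i = fst p \<bullet> x + snd p" by (intro exI[of _ "(a, b)"]) simp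
    qed
    then obtain s where s: "\<And>i. s i \<in> S i" "\<And>i. P x $ i = fst (s i) \<bullet> x + snd (s i)" by blast
    have "P x = affine_map (\<chi> i. fst (s i), \<chi> i. snd (s i)) x"
      by (simp add: vec_eq_iff affine_map_def matrix_vector_mul_component s(2))
    moreover have "(\<chi> i. fst (s i), \<chi> i. snd (s i)) \<in> \<A>"
      unfolding \<A>_def using s(1) by (intro imageI) auto
    ultimately show ?thesis by blast
  qed
  moreover have "\<exists>L. L-lipschitz_on UNIV P"
    using assms unfolding piecewise_affine_function_def by (intro lipschitz_on_vec_ex) blast
  ultimately show thesis using that by blast
qed

section \<open>Evaluation procedures\<close>

lemma length_run [simp]: "length (run ops v) = length v + length ops"
  by (induction ops arbitrary: v) auto

lemma length_run_increments [simp]: "length (run_increments V ops d) = length d + length ops"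
  by (induction ops arbitrary: d) auto

lemma run_nth_prefix: "k < length v \<Longrightarrow> run ops v ! k = v ! k"
proof (induction ops arbitrary: v)
  case (Cons a ops)
  from Cons.IH[of "v @ [op_value v a]"] Cons.prems show ?case by (simp add: nth_append)
qed simp

lemma run_increments_nth_prefix: "k < length d \<Longrightarrow> run_increments V ops d ! k = d ! k"
proof (induction ops arbitrary: d)
  case (Cons a ops)
  from Cons.IH[of "d @ [op_increment V d a]"] Cons.prems show ?case by (simp add: nth_append)
qed simp

lemma op_value_cong: "(\<And>j. j \<in> operands a \<Longrightarrow> v ! j = w ! j) \<Longrightarrow> op_value v a = op_value w a"
  by (cases a) auto

lemma op_increment_cong:
  "(\<And>j. j \<in> operands a \<Longrightarrow> d ! j = e ! j) \<Longrightarrow> op_increment V d a = op_increment V e a"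
  by (cases a) auto

text \<open>Positions never change once they are filled, so each value satisfies its defining
  equation with the finished list in place of the prefix from which it was computed.\<close>

lemma run_nth:
  assumes "k < length ops" "operands (ops ! k) \<subseteq> {..<length v + k}"
  shows "run ops v ! (length v + k) = op_value (run ops v) (ops ! k)"
  using assms
proof (induction ops arbitrary: v k)
  case (Cons a ops)
  let ?w = "v @ [op_value v a]"
  show ?case
  proof (cases k)
    case 0
    have "op_value v a = op_value (run ops ?w) a"
      using Cons.prems 0 by (intro op_value_cong) (auto simp: run_nth_prefix nth_append)
    moreover have "run ops ?w ! length v = op_value v a" by (simp add: run_nth_prefix)
    ultimately show ?thesis using 0 by simp
  next
    case (Suc l)
    with Cons.IH[of l ?w] Cons.prems show ?thesis by simp
  qed
qed simp

lemma run_increments_nth: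
  assumes "k < length ops" "operands (ops ! k) \<subseteq> {..<length d + k}"
  shows "run_increments V ops d ! (length d + k) = op_increment V (run_increments V ops d) (ops ! k)"
  using assms
proof (induction ops arbitrary: d k)
  case (Cons a ops)
  let ?w = "d @ [op_increment V d a]"
  show ?case
  proof (cases k)
    case 0
    have "op_increment V d a = op_increment V (run_increments V ops ?w) a"
      using Cons.prems 0 by (intro op_increment_cong) (auto simp: run_increments_nth_prefix nth_append)
    moreover have "run_increments V ops ?w ! length d = op_increment V d a"
      by (simp add: run_increments_nth_prefix)
    ultimately show ?thesis using 0 by simp
  next
    case (Suc l)
    with Cons.IH[of l ?w] Cons.prems show ?thesis by simp
  qed
qed simp

lemma length_components [simp]: "length (components \<iota> (x :: real^'n)) = CARD('n)"
  by (simp add: components_def)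

lemma components_nth: "k < CARD('n) \<Longrightarrow> components \<iota> (x :: real^'n) ! k = x $ inv \<iota> k"
  by (simp add: components_def)

section \<open>First order approximation of intermediate values\<close>

text \<open>The increment d is a function of the point x, not of the displacement x - c, so d c = 0
  says that zero displacement gives zero increment.\<close>

definition tangent_approximation :: "(real^'n \<Rightarrow> real) \<Rightarrow> (real^'n \<Rightarrow> real) \<Rightarrow> real^'n \<Rightarrow> bool" where
  "tangent_approximation f d c \<longleftrightarrow> piecewise_affine_function d \<and> d c = 0 \<and>
     (\<lambda>x. f x - f c - d x) \<in> o[at c](\<lambda>x. norm (x - c))"

lemma tangent_approximationD:
  assumes "tangent_approximation f d c"
  shows "piecewise_affine_function d" "d c = 0"
    "(\<lambda>x. f x - f c - d x) \<in> o[at c](\<lambda>x. norm (x - c))"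
    "d \<in> O[at c](\<lambda>x. norm (x - c))"
    "(\<lambda>x. f x - f c) \<in> O[at c](\<lambda>x. norm (x - c))"
proof -
  show pa: "piecewise_affine_function d" "d c = 0"
    and e: "(\<lambda>x. f x - f c - d x) \<in> o[at c](\<lambda>x. norm (x - c))"
    using assms by (simp_all add: tangent_approximation_def)
  show d: "d \<in> O[at c](\<lambda>x. norm (x - c))"
    by (rule piecewise_affine_function_bigo[OF pa])
  have "(\<lambda>x. (f x - f c - d x) + d x) \<in> O[at c](\<lambda>x. norm (x - c))"
    by (intro sum_in_bigo d landau_o.small_imp_big e)
  then show "(\<lambda>x. f x - f c) \<in> O[at c](\<lambda>x. norm (x - c))" by simp
qed

lemma bigo_mult_smallo_1:
  fixes f g n :: "'a \<Rightarrow> real"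
  assumes "f \<in> o[F](\<lambda>_. 1)" "g \<in> O[F](n)"
  shows "(\<lambda>x. f x * g x) \<in> o[F](n)"
  using landau_o.small_big_mult[OF assms] by simp

lemma norm_diff_smallo_1: "(\<lambda>x. norm (x - c)) \<in> o[at c](\<lambda>_. 1 :: real)"
proof (rule smalloI_tendsto)
  have "((\<lambda>x. norm (x - c)) \<longlongrightarrow> norm (c - c)) (at c)" by (intro tendsto_intros)
  then show "((\<lambda>x. norm (x - c) / 1) \<longlongrightarrow> 0) (at c)" by simp
qed simp

lemma tangent_approximation_combination:
  assumes f: "tangent_approximation f df c" and g: "tangent_approximation g dg c"
  shows "tangent_approximation (\<lambda>x. r * f x + s * g x + t) (\<lambda>x. r * df x + s * dg x) c"
proof -
  have "(\<lambda>x. r * (f x - f c - df x) + s * (g x - g c - dg x)) \<in> o[at c](\<lambda>x. norm (x - c))"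
    using tangent_approximationD(3)[OF f] tangent_approximationD(3)[OF g]
    by (intro sum_in_smallo) (cases "r = 0"; cases "s = 0"; simp)+
  moreover have "piecewise_affine_function (\<lambda>x. r * df x + s * dg x)"
    using piecewise_affine_function_combination[OF tangent_approximationD(1)[OF f] tangent_approximationD(1)[OF g], of r s 0]
    by simp
  ultimately show ?thesis
    using tangent_approximationD(2)[OF f] tangent_approximationD(2)[OF g]
    by (simp add: tangent_approximation_def algebra_simps)
qed

text \<open>The error is (f x - f c) (g x - g c) plus constant multiples of the two given errors,
  and the product is an o(1) term times an O(|x - c|) term.\<close>

lemma tangent_approximation_mult:
  assumes f: "tangent_approximation f df c" and g: "tangent_approximation g dg c"
  shows "tangent_approximation (\<lambda>x. f x * g x) (\<lambda>x. f c * dg x + df x * g c) c"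
proof -
  note F = tangent_approximationD[OF f] and G = tangent_approximationD[OF g]
  have "(\<lambda>x. f x - f c) \<in> o[at c](\<lambda>_. 1)"
    by (rule landau_o.big_small_trans[OF F(5) norm_diff_smallo_1])
  from bigo_mult_smallo_1[OF this G(5)]
  have "(\<lambda>x. (f x - f c) * (g x - g c)) \<in> o[at c](\<lambda>x. norm (x - c))" .
  moreover have "(\<lambda>x. f c * (g x - g c - dg x)) \<in> o[at c](\<lambda>x. norm (x - c))"
    using G(3) by (cases "f c = 0") simp_all
  moreover have "(\<lambda>x. g c * (f x - f c - df x)) \<in> o[at c](\<lambda>x. norm (x - c))"
    using F(3) by (cases "g c = 0") simp_all
  ultimately have "(\<lambda>x. (f x - f c) * (g x - g c) + f c * (g x - g c - dg x) + g c * (f x - f c - df x))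
      \<in> o[at c](\<lambda>x. norm (x - c))"
    by (intro sum_in_smallo)
  moreover have "piecewise_affine_function (\<lambda>x. f c * dg x + df x * g c)"
    using piecewise_affine_function_combination[OF G(1) F(1), of "f c" "g c" 0] by (simp add: mult.commute)
  ultimately show ?thesis
    using F(2) G(2) by (simp add: tangent_approximation_def algebra_simps)
qed

text \<open>With the slope function g of Caratheodory the error is (g (f x) - l) (f x - f c) + l (f
  x - f c - df x), where g (f x) - l tends to 0.\<close>

lemma tangent_approximation_compose:
  assumes f: "tangent_approximation f df c" and cont: "isCont f c"
    and \<phi>: "(\<phi> has_real_derivative l) (at (f c))"
  shows "tangent_approximation (\<lambda>x. \<phi> (f x)) (\<lambda>x. l * df x) c"
proof -
  note F = tangent_approximationD[OF f]
  obtain g where g: "\<And>z. \<phi> z - \<phi> (f c) = g z * (z - f c)" "isCont g (f c)" "g (f c) = l"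
    using \<phi> unfolding CARAT_DERIV by blast
  have "((\<lambda>x. g (f x) - l) \<longlongrightarrow> g (f c) - l) (at c)"
    using isCont_o2[OF cont g(2)] by (intro tendsto_intros) (simp add: isCont_def)
  then have "(\<lambda>x. g (f x) - l) \<in> o[at c](\<lambda>_. 1)"
    using g(3) by (intro smalloI_tendsto) simp_all
  from bigo_mult_smallo_1[OF this F(5)]
  have "(\<lambda>x. (g (f x) - l) * (f x - f c)) \<in> o[at c](\<lambda>x. norm (x - c))" .
  moreover have "(\<lambda>x. l * (f x - f c - df x)) \<in> o[at c](\<lambda>x. norm (x - c))"
    using F(3) by (cases "l = 0") simp_all
  ultimately have "(\<lambda>x. (g (f x) - l) * (f x - f c) + l * (f x - f c - df x)) \<in> o[at c](\<lambda>x. norm (x - c))"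
    by (rule sum_in_smallo)
  then have "(\<lambda>x. \<phi> (f x) - \<phi> (f c) - l * df x) \<in> o[at c](\<lambda>x. norm (x - c))"
    unfolding g(1) by (simp add: algebra_simps)
  moreover have "piecewise_affine_function (\<lambda>x. l * df x)"
    using piecewise_affine_function_combination[OF F(1) F(1), of l 0 0] by simp
  ultimately show ?thesis
    using F(2) by (simp add: tangent_approximation_def)
qed

text \<open>The absolute value is 1-Lipschitz, so |f x| and |f c + df x| differ by at most the error
  of f, whatever the sign of f c. This is the gain from keeping abs in the model instead of
  linearizing it.\<close>

lemma tangent_approximation_abs:
  assumes f: "tangent_approximation f df c"
  shows "tangent_approximation (\<lambda>x. \<bar>f x\<bar>) (\<lambda>x. \<bar>f c + df x\<bar> - \<bar>f c\<bar>) c"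
proof -
  note F = tangent_approximationD[OF f]
  have "(\<lambda>x. \<bar>f x\<bar> - \<bar>f c\<bar> - (\<bar>f c + df x\<bar> - \<bar>f c\<bar>)) \<in> O[at c](\<lambda>x. f x - f c - df x)"
    by (intro bigoI[of _ 1]) (auto intro!: always_eventually)
  then have "(\<lambda>x. \<bar>f x\<bar> - \<bar>f c\<bar> - (\<bar>f c + df x\<bar> - \<bar>f c\<bar>)) \<in> o[at c](\<lambda>x. norm (x - c))"
    using F(3) by (rule landau_o.big_small_trans)
  moreover have "piecewise_affine_function (\<lambda>x. \<bar>f c + df x\<bar> - \<bar>f c\<bar>)"
  proof -
    have "piecewise_affine_function (\<lambda>x. \<bar>f c + df x\<bar>)"
      using piecewise_affine_function_abs[OF piecewise_affine_function_combination[OF F(1) F(1), of 1 0 "f c"]]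
      by (simp add: add.commute)
    from piecewise_affine_function_combination[OF this this, of 1 0 "- \<bar>f c\<bar>"] show ?thesis by simp
  qed
  ultimately show ?thesis
    using F(2) by (simp add: tangent_approximation_def)
qed

lemma tangent_approximation_component:
  "tangent_approximation (\<lambda>x. x $ i) (\<lambda>x. (x - c) $ i) c"
proof -
  have "piecewise_affine_function (\<lambda>x. (x - c) $ i)"
    using piecewise_affine_function_affine[of "axis i 1" "- c $ i"]
    by (simp add: inner_commute[of "axis i 1"] inner_axis)
  then show ?thesis by (simp add: tangent_approximation_def)
qed

lemma elemental_has_derivative:
  assumes "elemental_library \<Phi>" "(D, \<phi>) \<in> \<Phi>" "t \<in> D"
  shows "(\<phi> has_real_derivative deriv \<phi> t) (at t)"
proof -
  have "open D" "\<phi> differentiable_on D"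
    using assms(1,2) unfolding elemental_library_def by auto
  with assms(3) have "\<phi> differentiable at t"
    by (simp add: differentiable_on_eq_differentiable_at)
  then show ?thesis by (simp add: DERIV_deriv_iff_real_differentiable)
qed

text \<open>Strong induction on the position, as operands come earlier. Continuity on all of U is
  carried along: it supplies continuity at c for the chain rule and, in the end, continuity of
  F.\<close>

lemma run_tangent_approximation:
  fixes \<iota> :: "'n::finite \<Rightarrow> nat" and m :: nat
  assumes lib: "elemental_library \<Phi>"
    and proc: "evaluation_procedure \<Phi> CARD('n) m ops"
    and wd: "\<And>x. x \<in> U \<Longrightarrow> well_defined_at \<iota> ops x"
    and U: "open U" "c \<in> U"
    and k: "k < CARD('n) + length ops"
  defines "R \<equiv> \<lambda>x. run ops (components \<iota> x)"
  defines "D \<equiv> \<lambda>x. run_increments (R c) ops (components \<iota> (x - c))"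
  shows "continuous_on U (\<lambda>x. R x ! k) \<and> tangent_approximation (\<lambda>x. R x ! k) (\<lambda>x. D x ! k) c"
  using k
proof (induction k rule: less_induct)
  case (less k)
  show ?case
  proof (cases "k < CARD('n)")
    case True
    then have "R x ! k = x $ inv \<iota> k" "D x ! k = (x - c) $ inv \<iota> k" for x
      unfolding R_def D_def by (simp_all add: run_nth_prefix run_increments_nth_prefix components_nth)
    then show ?thesis
      using tangent_approximation_component[of "inv \<iota> k" c]
      by (simp add: continuous_on_component)
  next
    case False
    define l where "l = k - CARD('n)"
    have l: "l < length ops" "k = CARD('n) + l" using False less.prems by (simp_all add: l_def)
    have opd: "operands (ops ! l) \<subseteq> {..<CARD('n) + l}"
      and elem: "\<And>f j. ops ! l = Elem f j \<Longrightarrow> f \<in> \<Phi>"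
      using proc l(1) unfolding evaluation_procedure_def by auto
    have Rk: "R x ! k = op_value (R x) (ops ! l)" for x
      using run_nth[of l ops "components \<iota> x"] l opd by (simp add: R_def)
    have Dk: "D x ! k = op_increment (R c) (D x) (ops ! l)" for x
      using run_increments_nth[of l ops "components \<iota> (x - c)"] l opd by (simp add: D_def)
    have IH: "continuous_on U (\<lambda>x. R x ! j)" "tangent_approximation (\<lambda>x. R x ! j) (\<lambda>x. D x ! j) c"
      if "j \<in> operands (ops ! l)" for j
    proof -
      have "j < k" using that opd l(2) by auto
      then show "continuous_on U (\<lambda>x. R x ! j)" "tangent_approximation (\<lambda>x. R x ! j) (\<lambda>x. D x ! j) c"
        using less.IH[of j] less.prems by auto
    qed
    show ?thesis
    proof (cases "ops ! l")
      case (Const a)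
      have "tangent_approximation (\<lambda>x :: real^'n. a) (\<lambda>x. 0) c"
        using piecewise_affine_function_affine[of "0 :: real^'n" 0] by (simp add: tangent_approximation_def)
      then show ?thesis by (simp add: Rk Dk Const)
    next
      case (Add i j)
      then have "i \<in> operands (ops ! l)" "j \<in> operands (ops ! l)" by auto
      note ij = IH[OF this(1)] IH[OF this(2)]
      show ?thesis
        using tangent_approximation_combination[OF ij(2,4), of 1 1 0] continuous_on_add[OF ij(1,3)]
        by (simp add: Rk Dk Add)
    next
      case (Sub i j)
      then have "i \<in> operands (ops ! l)" "j \<in> operands (ops ! l)" by auto
      note ij = IH[OF this(1)] IH[OF this(2)]
      show ?thesis
        using tangent_approximation_combination[OF ij(2,4), of 1 "-1" 0] continuous_on_diff[OF ij(1,3)]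
        by (simp add: Rk Dk Sub)
    next
      case (Mul i j)
      then have "i \<in> operands (ops ! l)" "j \<in> operands (ops ! l)" by auto
      note ij = IH[OF this(1)] IH[OF this(2)]
      show ?thesis
        using tangent_approximation_mult[OF ij(2,4)] continuous_on_mult[OF ij(1,3)]
        by (simp add: Rk Dk Mul)
    next
      case (Elem f j)
      then have j: "j \<in> operands (ops ! l)" by auto
      obtain E \<phi> where f: "f = (E, \<phi>)" by (cases f)
      have mem: "(E, \<phi>) \<in> \<Phi>" using elem[OF Elem] f by simp
      have "Elem (E, \<phi>) j \<in> set ops" using Elem l(1) f nth_mem by metis
      then have E: "R x ! j \<in> E" if "x \<in> U" for x
        using wd[OF that] unfolding well_defined_at_def R_def by blast
      have cont: "isCont (\<lambda>x. R x ! j) c"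
        using IH(1)[OF j] U by (simp add: continuous_on_eq_continuous_at)
      have "continuous_on E \<phi>"
        using elemental_has_derivative[OF lib mem] DERIV_isCont
        by (intro continuous_at_imp_continuous_on) blast
      then have "continuous_on U (\<lambda>x. \<phi> (R x ! j))"
        using E by (intro continuous_on_compose2[OF _ IH(1)[OF j]]) auto
      moreover have "tangent_approximation (\<lambda>x. \<phi> (R x ! j)) (\<lambda>x. deriv \<phi> (R c ! j) * D x ! j) c"
        by (rule tangent_approximation_compose[OF IH(2)[OF j] cont elemental_has_derivative[OF lib mem E[OF U(2)]]])
      ultimately show ?thesis by (simp add: Rk Dk Elem f)
    next
      case (Abs j)
      then have j: "j \<in> operands (ops ! l)" by auto
      show ?thesis
        using tangent_approximation_abs[OF IH(2)[OF j]] continuous_on_rabs[OF IH(1)[OF j]]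
        by (simp add: Rk Dk Abs)
    qed
  qed
qed

section \<open>Reduction to a well-ordered index type\<close>

text \<open>The change of variables theorem of the library requires a well-ordered index type.\<close>

typedef 'a ordered_index = "{..<CARD('a::finite)}"
  using zero_less_card_finite by blast

instance ordered_index :: (finite) finite
proof
  show "finite (UNIV :: 'a ordered_index set)"
    using type_definition.Rep_range[OF type_definition_ordered_index]
    by (metis finite_imageD finite_lessThan Rep_ordered_index_inject injI)
qed

instantiation ordered_index :: (finite) wellorder
begin

definition less_eq_ordered_index :: "'a ordered_index \<Rightarrow> 'a ordered_index \<Rightarrow> bool" where
  "x \<le> y \<longleftrightarrow> Rep_ordered_index x \<le> Rep_ordered_index y"

definition less_ordered_index :: "'a ordered_index \<Rightarrow> 'a ordered_index \<Rightarrow> bool" where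
  "x < y \<longleftrightarrow> Rep_ordered_index x < Rep_ordered_index y"

instance
proof
  fix P :: "'a ordered_index \<Rightarrow> bool" and a :: "'a ordered_index"
  assume step: "\<And>x. (\<And>y. y < x \<Longrightarrow> P y) \<Longrightarrow> P x"
  show "P a"
  proof (induction a rule: measure_induct_rule[where f = Rep_ordered_index])
    case (less x)
    show ?case
      by (rule step, rule less.IH) (simp add: less_ordered_index_def)
  qed
qed (auto simp: less_eq_ordered_index_def less_ordered_index_def Rep_ordered_index_inject)

end

lemma CARD_ordered_index: "CARD('a::finite ordered_index) = CARD('a)"
  using type_definition.card[OF type_definition_ordered_index] by simp

section \<open>Transport of regularity and openness\<close>

text \<open>T maps fibres of P onto fibres of the conjugated map and preserves distances, so the
  same constant works with the preimages of U and V under S.\<close>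

lemma metrically_regular_at_isometry:
  fixes T :: "'a::real_normed_vector \<Rightarrow> 'b::real_normed_vector"
  assumes ST: "\<And>x. S (T x) = x" and TS: "\<And>y. T (S y) = y"
    and dist: "\<And>x y. dist (T x) (T y) = dist x y"
    and reg: "metrically_regular_at P (S w)"
  shows "metrically_regular_at (\<lambda>y. T (P (S y))) w"
proof -
  have dS: "dist (S x) (S y) = dist x y" for x y using dist[of "S x" "S y"] by (simp add: TS)
  have contS: "continuous_on UNIV S"
    unfolding continuous_on_iff using dS by auto
  obtain c U V where c: "c > 0" and U: "S w \<in> interior U" and V: "P (S w) \<in> interior V"
    and reg': "\<And>x y. x \<in> U \<Longrightarrow> y \<in> V \<Longrightarrow> set_distance x (P -` {y}) \<le> ennreal (c * norm (y - P x))"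
    using reg unfolding metrically_regular_at_def by blast
  have int: "y \<in> interior (S -` A)" if "S y \<in> interior A" for y A
  proof (rule interiorI)
    show "open (S -` interior A)"
      using open_vimage[OF open_interior contS] .
    show "S -` interior A \<subseteq> S -` A" using interior_subset by blast
  qed (use that in simp)
  have "set_distance x ((\<lambda>y. T (P (S y))) -` {y}) \<le> ennreal (c * norm (y - T (P (S x))))"
    if "x \<in> S -` U" "y \<in> S -` V" for x y
  proof -
    have "(\<lambda>y. T (P (S y))) -` {y} = T ` (P -` {S y})"
      by (auto simp: ST TS) (metis ST TS imageI vimageI2 vimage_singleton_eq)
    moreover have "dist x (T u) = dist (S x) u" for u
      using dist[of "S x" u] by (simp add: TS)
    ultimately have "set_distance x ((\<lambda>y. T (P (S y))) -` {y}) = set_distance (S x) (P -` {S y})"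
      by (simp add: set_distance_def image_comp comp_def)
    also have "\<dots> \<le> ennreal (c * norm (S y - P (S x)))"
      using that by (intro reg') auto
    also have "norm (S y - P (S x)) = norm (y - T (P (S x)))"
      using dist[of "S y" "P (S x)"] by (simp add: TS dist_norm)
    finally show ?thesis .
  qed
  moreover have "w \<in> interior (S -` U)" "T (P (S w)) \<in> interior (S -` V)"
    using U V by (auto intro!: int simp: ST)
  ultimately show ?thesis
    unfolding metrically_regular_at_def using c by blast
qed

lemma open_in_point_conjugate:
  fixes T :: "'a::metric_space \<Rightarrow> 'b::metric_space"
  assumes ST: "\<And>x. S (T x) = x" and TS: "\<And>y. T (S y) = y"
    and contT: "continuous_on UNIV T" and contS: "continuous_on UNIV S"
    and op: "open_in_point (\<lambda>y. T (F (S y))) (T c)"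
  shows "open_in_point F c"
  unfolding open_in_point_def
proof (intro allI impI)
  fix N assume N: "c \<in> interior N"
  have "T c \<in> interior (S -` N)"
  proof (rule interiorI)
    show "open (S -` interior N)" using open_vimage[OF open_interior contS] .
    show "S -` interior N \<subseteq> S -` N" using interior_subset by blast
  qed (simp add: ST N)
  then have "T (F c) \<in> interior ((\<lambda>y. T (F (S y))) ` (S -` N))"
    using op unfolding open_in_point_def by (metis ST)
  also have "(\<lambda>y. T (F (S y))) ` (S -` N) = T ` F ` S ` (S -` N)"
    by (simp only: image_image)
  also have "S ` (S -` N) = N"
    using ST by (metis surj_def surj_image_vimage_eq)
  finally have "T (F c) \<in> interior (T ` F ` N)" .
  show "F c \<in> interior (F ` N)"
  proof (rule interiorI)
    show "open (T -` interior (T ` F ` N))" using open_vimage[OF open_interior contT] .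
    show "T -` interior (T ` F ` N) \<subseteq> F ` N"
    proof
      fix z assume "z \<in> T -` interior (T ` F ` N)"
      then have "T z \<in> T ` F ` N" using interior_subset by blast
      then show "z \<in> F ` N" by (metis ST imageE)
    qed
  qed (simp add: \<open>T (F c) \<in> interior (T ` F ` N)\<close>)
qed

text \<open>Relabelling coordinates along a bijection \<pi> is a linear isometry T with inverse S,
  and all hypotheses are conjugated by it with unchanged constants. The pieces are conjugated too,
  and the hyperplanes are taken from the conjugated pieces.\<close>

lemma open_in_point_perturbed:
  fixes P F :: "real^'n \<Rightarrow> real^'n"
  assumes pieces: "finite \<A>" "\<And>x. \<exists>C\<in>\<A>. P x = affine_map C x"
    and lip: "L-lipschitz_on UNIV P"
    and W: "open W" "c \<in> W" "\<And>w. w \<in> W \<Longrightarrow> metrically_regular_at P w"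
    and F: "open U" "c \<in> U" "continuous_on U F" "F c = P c"
    and approx: "\<And>\<epsilon>. \<epsilon> > 0 \<Longrightarrow> \<exists>d>0. \<forall>x\<in>ball c d. norm (F x - P x) \<le> \<epsilon> * norm (x - c)"
  shows "open_in_point F c"
proof -
  obtain \<pi> :: "'n ordered_index \<Rightarrow> 'n" where \<pi>: "bij \<pi>"
    using finite_same_card_bij[of "UNIV :: 'n ordered_index set" "UNIV :: 'n set"] CARD_ordered_index[where 'a='n]
    by auto
  define T :: "real^'n \<Rightarrow> real^'n ordered_index" where "T x = (\<chi> k. x $ \<pi> k)" for x
  define S :: "real^'n ordered_index \<Rightarrow> real^'n" where "S y = (\<chi> i. y $ inv \<pi> i)" for y
  have ST: "S (T x) = x" for x
    using \<pi> by (simp add: S_def T_def vec_eq_iff bij_is_surj surj_f_inv_f)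
  have TS: "T (S y) = y" for y
    using \<pi> by (simp add: S_def T_def vec_eq_iff bij_is_inj inv_f_f)
  have linT: "linear T" and linS: "linear S"
    by (auto intro!: linearI simp: T_def S_def vec_eq_iff)
  have normT: "norm (T x) = norm x" for x
    unfolding norm_vec_def L2_set_def T_def
    using sum.reindex_bij_betw[OF \<pi>, of "\<lambda>i. (norm (x $ i))\<^sup>2"] by simp
  have normS: "norm (S y) = norm y" for y
    using normT[of "S y"] by (simp add: TS)
  have distT: "dist (T x) (T y) = dist x y" for x y
    using normT[of "x - y"] by (simp add: dist_norm linear_diff[OF linT])
  have distS: "dist (S x) (S y) = dist x y" for x y
    using distT[of "S x" "S y"] by (simp add: TS)
  have contT: "continuous_on X T" and contS: "continuous_on Y S" for X Y
    using linT linS by (auto simp: linear_continuous_on linear_linear)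
  define P' F' where "P' y = T (P (S y))" and "F' y = T (F (S y))" for y
  define \<A>' where "\<A>' = (\<lambda>C. (matrix (\<lambda>v. T (fst C *v S v)), T (snd C))) ` \<A>"
  have "finite \<A>'" using pieces(1) by (simp add: \<A>'_def)
  then obtain \<H> where \<H>: "finite \<H>" "\<And>a b. (a, b) \<in> \<H> \<Longrightarrow> a \<noteq> 0"
    "\<And>C D x. C \<in> \<A>' \<Longrightarrow> D \<in> \<A>' \<Longrightarrow> C \<noteq> D \<Longrightarrow> affine_map C x = affine_map D x \<Longrightarrow>
      \<exists>(a, b)\<in>\<H>. a \<bullet> x = b"
    by (rule affine_coincidence_hyperplanes) blast
  have "piecewise_affine P' \<A>' \<H> L"
  proof (unfold_locales; (fact \<H> \<open>finite \<A>'\<close>)?)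
    fix y
    obtain C where C: "C \<in> \<A>" "P (S y) = affine_map C (S y)" using pieces(2) by blast
    have "linear (\<lambda>v. T (fst C *v S v))"
      using linear_compose[OF linear_compose[OF linS matrix_vector_mul_linear[of "fst C"]] linT]
      by (simp add: comp_def)
    then have "affine_map (matrix (\<lambda>v. T (fst C *v S v)), T (snd C)) y = P' y"
      by (simp add: affine_map_def P'_def C(2) linear_add[OF linT] fun_cong[OF matrix_vector_mul(2)])
    with C(1) show "\<exists>C\<in>\<A>'. P' y = affine_map C y"
      unfolding \<A>'_def by (metis (no_types, lifting) imageI)
  next
    show "L-lipschitz_on UNIV P'"
      using lip unfolding lipschitz_on_def P'_def by (simp add: distT) (metis distS)
  qed
  then have "open_in_point F' (T c)"
  proof (rule open_in_point_perturbed_wellorder[where W = "S -` W" and U = "S -` U"])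
    show "open (S -` W)" "open (S -` U)"
      using W(1) F(1) contS[of UNIV] by (simp_all add: open_vimage)
    show "T c \<in> S -` W" "T c \<in> S -` U" using W F by (simp_all add: ST)
    show "metrically_regular_at P' w" if "w \<in> S -` W" for w
      using metrically_regular_at_isometry[where S = S and T = T and P = P, OF ST TS distT W(3)] that
      by (simp add: P'_def[abs_def])
    have "continuous_on (S -` U) (\<lambda>y. F (S y))"
      by (rule continuous_on_compose2[OF F(3) contS]) auto
    then show "continuous_on (S -` U) F'"
      unfolding F'_def by (rule continuous_on_compose2[OF contT[of UNIV]]) auto
    show "F' (T c) = P' (T c)" using F(4) by (simp add: F'_def P'_def ST)
    fix \<epsilon> :: real assume "\<epsilon> > 0"
    then obtain d where d: "d > 0" "\<And>x. x \<in> ball c d \<Longrightarrow> norm (F x - P x) \<le> \<epsilon> * norm (x - c)"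
      using approx by blast
    have "norm (F' y - P' y) \<le> \<epsilon> * norm (y - T c)" if "y \<in> ball (T c) d" for y
    proof -
      have eq: "dist (S y) c = dist y (T c)" using distT[of "S y" c] by (simp add: TS)
      then have "S y \<in> ball c d" using that by (simp add: dist_commute)
      from d(2)[OF this] show ?thesis
        using eq distT[of "F (S y)" "P (S y)"] by (simp add: F'_def P'_def dist_norm)
    qed
    with d(1) show "\<exists>d>0. \<forall>y\<in>ball (T c) d. norm (F' y - P' y) \<le> \<epsilon> * norm (y - T c)" by blast
  qed
  then show ?thesis
    unfolding F'_def by (rule open_in_point_conjugate[where S = S and T = T, OF ST TS contT contS])
qed

section \<open>Openness\<close>

theorem proposition3p12:
  fixes \<Phi> :: "elemental set"
    and \<iota> :: "'n::finite \<Rightarrow> nat"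
    and ops :: "operation list"
    and F :: "real ^ 'n \<Rightarrow> real ^ 'n"
    and xs :: "real ^ 'n"
    and U W :: "(real ^ 'n) set"
  assumes "elemental_library \<Phi>"
    and "numbering \<iota>"
    and "open U" and "xs \<in> U" and "computed_on \<Phi> \<iota> \<iota> ops U F"
    and "F xs = 0"
    and "open W" and "xs \<in> W"
    and "metrically_regular_on (piecewise_linearization \<iota> \<iota> ops xs) W"
  shows "open_in_point F xs"
proof -
  define P where "P = piecewise_linearization \<iota> \<iota> ops xs"
  define R where "R x = run ops (components \<iota> x)" for x
  define D where "D x = run_increments (R xs) ops (components \<iota> (x - xs))" for x
  \<comment> \<open>The outputs are the last CARD('n) of CARD('n) + length ops values, so they begin
    at position length ops.\<close>
  define k where "k i = length ops + \<iota> i" for i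
  have proc: "evaluation_procedure \<Phi> CARD('n) CARD('n) ops"
    and wd: "\<And>x. x \<in> U \<Longrightarrow> well_defined_at \<iota> ops x"
    and F: "\<And>x. x \<in> U \<Longrightarrow> F x = eval_procedure \<iota> \<iota> ops x"
    using assms(5) unfolding computed_on_def by auto
  have k: "k i < CARD('n) + length ops" for i
  proof -
    have "\<iota> i < CARD('n)" using assms(2) unfolding numbering_def bij_betw_def by blast
    then show ?thesis by (simp add: k_def)
  qed
  have cont: "continuous_on U (\<lambda>x. R x ! k i)"
    and tangent: "tangent_approximation (\<lambda>x. R x ! k i) (\<lambda>x. D x ! k i) xs" for i
    using run_tangent_approximation[OF assms(1) proc wd assms(3,4) k] by (simp_all add: R_def D_def)
  have eval: "eval_procedure \<iota> \<iota> ops x $ i = R x ! k i" for x i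
    by (simp add: eval_procedure_def final_vector_def R_def k_def)
  have P: "P x $ i = R xs ! k i + D x ! k i" for x i
    by (simp add: P_def piecewise_linearization_def eval tangent_increment_def final_vector_def
        D_def R_def k_def)
  have "piecewise_affine_function (\<lambda>x. P x $ i)" for i
    using piecewise_affine_function_combination[OF tangent_approximationD(1)[OF tangent[of i]]
        tangent_approximationD(1)[OF tangent[of i]], of 1 0 "R xs ! k i"]
    by (simp add: P add.commute)
  then obtain \<A> L where \<A>: "finite \<A>" "\<And>x. \<exists>C\<in>\<A>. P x = affine_map C x" and L: "L-lipschitz_on UNIV P"
    using piecewise_affine_vector by blast
  have Pxs: "F xs = P xs"
    using tangent_approximationD(2)[OF tangent] by (simp add: vec_eq_iff P F[OF assms(4)] eval)
  show ?thesis
  proof (rule open_in_point_perturbed[where P = P, OF \<A>(1) _ L assms(7,8) _ assms(3,4)])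
    show "\<exists>C\<in>\<A>. P x = affine_map C x" for x by (rule \<A>(2))
    show "F xs = P xs" by (rule Pxs)
    show "metrically_regular_at P w" if "w \<in> W" for w
      using assms(9) that unfolding metrically_regular_on_def P_def by blast
    have "continuous_on U (\<lambda>x. \<chi> i. R x ! k i)"
      by (intro continuous_on_vec_lambda cont)
    then show "continuous_on U F"
      by (rule continuous_on_eq) (simp add: vec_eq_iff F eval)
    fix \<epsilon> :: real assume \<epsilon>: "\<epsilon> > 0"
    \<comment> \<open>The share \<epsilon> / CARD('n) per component adds up to \<epsilon> in the sum
      of absolute values that bounds the norm.\<close>
    have "\<forall>\<^sub>F x in at xs. \<forall>i. norm (R x ! k i - R xs ! k i - D x ! k i) \<le> \<epsilon> / CARD('n) * norm (norm (x - xs))"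
      using landau_o.smallD[OF tangent_approximationD(3)[OF tangent], of "\<epsilon> / CARD('n)"] \<epsilon>
      by (intro eventually_all_finite) simp
    moreover have "\<forall>\<^sub>F x in at xs. x \<in> U"
      using assms(3,4) by (rule eventually_at_in_open')
    ultimately have "\<forall>\<^sub>F x in at xs. norm (F x - P x) \<le> \<epsilon> * norm (x - xs)"
    proof eventually_elim
      case (elim x)
      have "norm (F x - P x) \<le> (\<Sum>i\<in>UNIV. \<bar>(F x - P x) $ i\<bar>)" by (rule norm_le_l1_cart)
      also have "\<dots> \<le> (\<Sum>i\<in>(UNIV::'n set). \<epsilon> / CARD('n) * norm (x - xs))"
        using elim by (intro sum_mono) (simp add: F eval P diff_diff_eq)
      finally show ?case by simp
    qed
    then obtain d where d: "d > 0" "\<And>x. x \<noteq> xs \<Longrightarrow> dist x xs < d \<Longrightarrow> norm (F x - P x) \<le> \<epsilon> * norm (x - xs)"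
      unfolding eventually_at by blast
    \<comment> \<open>The filter \<open>at xs\<close> leaves out the centre, where both sides are 0
      because \<open>F\<close> and \<open>P\<close> agree.\<close>
    have "norm (F x - P x) \<le> \<epsilon> * norm (x - xs)" if "x \<in> ball xs d" for x
      using d(2)[of x] that Pxs by (cases "x = xs") (auto simp: dist_commute)
    with d(1) show "\<exists>d>0. \<forall>x\<in>ball xs d. norm (F x - P x) \<le> \<epsilon> * norm (x - xs)" by blast
  qed
qed

end
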